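(* Let $\mathcal F$ be a family of pairwise commuting nonzero normal operators in $B(\mathcal H)$, let $\mathcal A$ be the (abelian) $C^*$-algebra generated by $\mathcal F$, and let $\phi:\mathcal A\to C_0(\Omega(\mathcal A))$ be the Gelfand representation. Let $\mathcal S(\mathcal F,\mathcal F^* )$ be the selfadjoint semigroup generated by $\mathcal F$. Then $\mathcal S(\mathcal F,\mathcal F^* )$ is simple if and only if the supports of the functions $\phi(N)$, $N\in\mathcal F\cup\mathcal F^*$, are all the same set $S$, and for every finite subset $\{N_i\}_{i=1}^n$ of $\mathcal F\cup\mathcal F^*$ ($n\ge1$) the projection $P:=\phi^{-1}(\chi_S)$ satisfies $P=\left(\prod_{i=1}^n N_i\right)W$ for some word $W\in\mathcal S(\mathcal F,\mathcal F^* )\cup\{I\}$.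
   Context: $\mathcal H$ is a complex Hilbert space and $B(\mathcal H)$ the bounded linear operators on it. $\mathcal F^*=\{N^*: N\in\mathcal F\}$, and $\mathcal S(\mathcal F,\mathcal F^* )$ is the set of all finite products (words) $A_1\cdots A_k$, $k\ge1$, with $A_i\in\mathcal F\cup\mathcal F^*$. By the Fuglede theorem these operators and their adjoints all commute, so $\mathcal A$ is abelian. $\Omega(\mathcal A)$ is the locally compact Hausdorff space of characters of $\mathcal A$, and $\phi$ is the Gelfand isometric $*$-isomorphism onto $C_0(\Omega(\mathcal A))$. The support of a function $f$ means its nonvanishing set $\{x: f(x)\ne0\}$ (no closure). $\chi_S$ is the characteristic function of $S$; the existence of $P$, i.e. $\chi_S\in C_0(\Omega(\mathcal A))$, is understood as part of the condition. An ideal of a semigroup $\mathcal S$ is a nonempty subset $J\subset\mathcal S$ with $XA, AX\in J$ for all $A\in J$, $X\in\mathcal S$; $\mathcal S$ is simple if its only ideal is $\mathcal S$ itself. *)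

theory Defs
  imports "HOL-Analysis.Analysis"
begin

section \<open>Complex Hilbert spaces\<close>

text \<open>The distribution only has real inner product spaces. The inner product is linear in its
  first argument; positive definiteness is contained in the axiom that expresses the norm
  through it.\<close>

class complex_hilbert = banach +
  fixes scaleC :: "complex \<Rightarrow> 'a \<Rightarrow> 'a"  (infixr "*\<^sub>C" 75)
    and cinner :: "'a \<Rightarrow> 'a \<Rightarrow> complex"
  assumes scaleC_add_right: "c *\<^sub>C (x + y) = c *\<^sub>C x + c *\<^sub>C y"
    and scaleC_add_left: "(c + d) *\<^sub>C x = c *\<^sub>C x + d *\<^sub>C x"
    and scaleC_scaleC: "c *\<^sub>C (d *\<^sub>C x) = (c * d) *\<^sub>C x"
    and scaleR_scaleC: "r *\<^sub>R x = complex_of_real r *\<^sub>C x"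
    and cinner_add_left: "cinner (x + y) z = cinner x z + cinner y z"
    and cinner_scaleC_left: "cinner (c *\<^sub>C x) y = c * cinner x y"
    and cinner_commute: "cinner x y = cnj (cinner y x)"
    and cinner_self: "cinner x x = complex_of_real ((norm x)\<^sup>2)"

instantiation complex :: complex_hilbert
begin

definition scaleC_complex :: "complex \<Rightarrow> complex \<Rightarrow> complex"
  where "scaleC_complex c z = c * z"

definition cinner_complex :: "complex \<Rightarrow> complex \<Rightarrow> complex"
  where "cinner_complex z w = z * cnj w"

instance
proof
  fix z :: complex
  show "cinner z z = complex_of_real ((norm z)\<^sup>2)"
    by (simp only: cinner_complex_def complex_norm_square)
qed (simp_all add: scaleC_complex_def cinner_complex_def algebra_simps scaleR_conv_of_real)

end

lemma norm_scaleC: "norm (c *\<^sub>C x) = cmod c * norm x" for x :: "'a::complex_hilbert"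
proof -
  have "cinner (c *\<^sub>C x) (c *\<^sub>C x) = c * cnj c * cinner x x"
    using cinner_commute[of x "c *\<^sub>C x"] cinner_commute[of x x]
    by (simp add: cinner_scaleC_left mult.assoc)
  also have "\<dots> = complex_of_real ((cmod c * norm x)\<^sup>2)"
    by (simp add: cinner_self complex_norm_square[symmetric] power_mult_distrib)
  finally have "(norm (c *\<^sub>C x))\<^sup>2 = (cmod c * norm x)\<^sup>2"
    by (simp only: cinner_self of_real_eq_iff)
  then show ?thesis
    by (simp add: power2_eq_iff_nonneg)
qed

section \<open>Bounded operators\<close>

text \<open>The type of bounded real-linear maps supplies composition and the operator norm;
  \<open>B(H)\<close> is its subset of complex-linear maps.\<close>

definition bounded_ops :: "('a::complex_hilbert \<Rightarrow>\<^sub>L 'a) set"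
  where "bounded_ops = {T. \<forall>c x. blinfun_apply T (c *\<^sub>C x) = c *\<^sub>C blinfun_apply T x}"

lift_definition op_scaleC :: "complex \<Rightarrow> ('a::complex_hilbert \<Rightarrow>\<^sub>L 'a) \<Rightarrow> 'a \<Rightarrow>\<^sub>L 'a"
  is "\<lambda>c T x. c *\<^sub>C T x"
proof -
  fix c :: complex and T :: "'a \<Rightarrow> 'a"
  assume "bounded_linear T"
  moreover have "bounded_linear (\<lambda>x::'a. c *\<^sub>C x)"
    by (rule bounded_linear_intro[where K = "cmod c"])
      (simp_all add: scaleC_add_right scaleR_scaleC scaleC_scaleC norm_scaleC mult.commute)
  ultimately show "bounded_linear (\<lambda>x. c *\<^sub>C T x)"
    by (rule bounded_linear_compose[rotated])
qed

definition adj :: "('a::complex_hilbert \<Rightarrow>\<^sub>L 'a) \<Rightarrow> 'a \<Rightarrow>\<^sub>L 'a"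
  where "adj T = (THE S. S \<in> bounded_ops \<and>
    (\<forall>x y. cinner (blinfun_apply T x) y = cinner x (blinfun_apply S y)))"

definition normal_op :: "('a::complex_hilbert \<Rightarrow>\<^sub>L 'a) \<Rightarrow> bool"
  where "normal_op N \<longleftrightarrow> N \<in> bounded_ops \<and> adj N o\<^sub>L N = N o\<^sub>L adj N"

definition op_prod :: "('a::complex_hilbert \<Rightarrow>\<^sub>L 'a) list \<Rightarrow> 'a \<Rightarrow>\<^sub>L 'a"
  where "op_prod As = foldr (o\<^sub>L) As id_blinfun"

section \<open>Operator semigroups\<close>

definition sa_semigroup :: "('a::complex_hilbert \<Rightarrow>\<^sub>L 'a) set \<Rightarrow> ('a \<Rightarrow>\<^sub>L 'a) set"
  where "sa_semigroup F = {op_prod As |As. As \<noteq> [] \<and> set As \<subseteq> F \<union> adj ` F}"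

definition semigroup_ideal :: "('a::complex_hilbert \<Rightarrow>\<^sub>L 'a) set \<Rightarrow> ('a \<Rightarrow>\<^sub>L 'a) set \<Rightarrow> bool"
  where "semigroup_ideal S J \<longleftrightarrow>
    J \<noteq> {} \<and> J \<subseteq> S \<and> (\<forall>A\<in>J. \<forall>X\<in>S. X o\<^sub>L A \<in> J \<and> A o\<^sub>L X \<in> J)"

definition simple_semigroup :: "('a::complex_hilbert \<Rightarrow>\<^sub>L 'a) set \<Rightarrow> bool"
  where "simple_semigroup S \<longleftrightarrow> (\<forall>J. semigroup_ideal S J \<longrightarrow> J = S)"

section \<open>Generated C*-algebras and the Gelfand representation\<close>

text \<open>C*-algebras are not required to contain the identity operator.\<close>

definition cstar_subalgebra :: "('a::complex_hilbert \<Rightarrow>\<^sub>L 'a) set \<Rightarrow> bool"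
  where "cstar_subalgebra A \<longleftrightarrow> A \<subseteq> bounded_ops \<and> closed A \<and> 0 \<in> A \<and>
    (\<forall>S\<in>A. \<forall>T\<in>A. S + T \<in> A \<and> S o\<^sub>L T \<in> A) \<and>
    (\<forall>c. \<forall>T\<in>A. op_scaleC c T \<in> A) \<and> (\<forall>T\<in>A. adj T \<in> A)"

definition cstar_generated :: "('a::complex_hilbert \<Rightarrow>\<^sub>L 'a) set \<Rightarrow> ('a \<Rightarrow>\<^sub>L 'a) set"
  where "cstar_generated F = cstar_subalgebra hull F"

text \<open>Functions on a subset are made extensional, so that equality of functions is equality on
  that subset.\<close>

definition characters :: "('a::complex_hilbert \<Rightarrow>\<^sub>L 'a) set \<Rightarrow> (('a \<Rightarrow>\<^sub>L 'a) \<Rightarrow> complex) set"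
  where "characters A = {\<omega> \<in> extensional A.
    (\<forall>S\<in>A. \<forall>T\<in>A. \<omega> (S + T) = \<omega> S + \<omega> T \<and> \<omega> (S o\<^sub>L T) = \<omega> S * \<omega> T) \<and>
    (\<forall>c. \<forall>T\<in>A. \<omega> (op_scaleC c T) = c * \<omega> T) \<and> (\<exists>T\<in>A. \<omega> T \<noteq> 0)}"

text \<open>The Gelfand topology is that of pointwise convergence on \<open>A\<close>.\<close>

definition char_space :: "('a::complex_hilbert \<Rightarrow>\<^sub>L 'a) set \<Rightarrow> (('a \<Rightarrow>\<^sub>L 'a) \<Rightarrow> complex) topology"
  where "char_space A = subtopology (product_topology (\<lambda>_. euclidean) A) (characters A)"

definition C0 :: "'b topology \<Rightarrow> ('b \<Rightarrow> complex) set"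
  where "C0 X = {f \<in> extensional (topspace X). continuous_map X euclidean f \<and>
    (\<forall>\<epsilon>>0. compactin X {x \<in> topspace X. \<epsilon> \<le> cmod (f x)})}"

definition gelfand ::
    "('a::complex_hilbert \<Rightarrow>\<^sub>L 'a) set \<Rightarrow> ('a \<Rightarrow>\<^sub>L 'a) \<Rightarrow> (('a \<Rightarrow>\<^sub>L 'a) \<Rightarrow> complex) \<Rightarrow> complex"
  where "gelfand A T = (\<lambda>\<omega>\<in>characters A. \<omega> T)"

text \<open>No closure is taken in the support.\<close>

definition supp_on :: "'b set \<Rightarrow> ('b \<Rightarrow> complex) \<Rightarrow> 'b set"
  where "supp_on X f = {x \<in> X. f x \<noteq> 0}"

definition char_fun :: "'b set \<Rightarrow> 'b set \<Rightarrow> 'b \<Rightarrow> complex"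
  where "char_fun X S = (\<lambda>x\<in>X. if x \<in> S then 1 else 0)"

lemma topspace_char_space: "topspace (char_space A) = characters A"
  by (auto simp: char_space_def characters_def PiE_def)

end

theory Submission
  imports Defs "HOL-Complex_Analysis.Complex_Analysis"
begin

text \<open>By Fuglede's theorem \<open>F \<union> F\<^sup>*\<close> commutes, so the semigroup is abelian, and a nonempty
  abelian semigroup is simple exactly if it is a group. The unit \<open>P\<close> of the group is idempotent,
  hence \<open>\<phi> P\<close> is an indicator function, and invertibility of \<open>N\<close> relative to \<open>P\<close> says that
  \<open>\<phi> N\<close> vanishes exactly where \<open>\<phi> P\<close> does. Conversely, factoring \<open>P = N W\<^sub>N\<close> for every generator
  \<open>N\<close> and multiplying these equations puts \<open>P\<close> into every ideal.

  Fuglede's theorem is Rosenblum's Liouville argument with the exponential \<open>exp(l M\<^sup>*)\<close> replaced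
  by the polynomials \<open>(1 + l M\<^sup>* / n)^n\<close>. Of Gelfand theory one needs that a selfadjoint \<open>T\<close>
  attains its norm at a character, and that indicators of compact open supports are in the range
  of \<open>\<phi>\<close>. Characters are found inside the Hilbert space: a maximal set of commuting operators with
  joint approximate null vectors contains \<open>R - l\<close> for exactly one scalar \<open>l\<close>, for each \<open>R\<close> in the
  algebra, and \<open>R \<mapsto> l\<close> is a character.\<close>

section \<open>Hilbert space preliminaries\<close>

text \<open>Two degenerate situations shape the proof: the Hilbert space may be zero, so that
  \<open>1 = 0\<close>, and the generated algebra need not contain the identity. Hence only
  \<open>norm 1 \<le> 1\<close> is available, functionals on the algebra are evaluated only at its
  own elements, and scalars are adjoined solely where a character is constructed. Building
  characters from vectors bypasses spectra, maximal ideals and the Gelfand-Mazur theorem;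
  selfadjointness of R enters through the identity \<open>cinner (R (R x)) x = norm (R x)^2\<close>.
  In Fuglede's theorem no limit of operators occurs: the polynomials have the same derivative at 0
  for every n, and only the bound on them improves as n grows. Full surjectivity of the Gelfand
  representation is not established. The indicator of S has to be reached only when it lies in C0;
  then S is compact, the transform of \<open>star N * N\<close> is bounded away from 0 on S, and
  polynomials without constant term in this single operator converge to the required
  projection.\<close>

lemma cinner_add_right: "cinner x (y + z) = cinner x y + cinner x z"
  by (metis cinner_add_left cinner_commute complex_cnj_add)

lemma cinner_scaleC_right: "cinner x (c *\<^sub>C y) = cnj c * cinner x y"
  by (metis cinner_commute cinner_scaleC_left complex_cnj_mult)

lemma scaleC_1 [simp]: "1 *\<^sub>C x = x"
  using scaleR_scaleC[of 1 x] by simp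

lemma scaleC_0_left [simp]: "0 *\<^sub>C x = 0"
  using scaleR_scaleC[of 0 x] by simp

lemma scaleC_0_right [simp]: "c *\<^sub>C (0::'a::complex_hilbert) = 0"
  using norm_scaleC[of c "0::'a"] by simp

lemma scaleC_minus1: "(-1) *\<^sub>C x = - x"
  using scaleR_scaleC[of "-1" x] by simp

lemma scaleC_minus_left: "(- c) *\<^sub>C x = - (c *\<^sub>C x)"
  using scaleC_scaleC[of "-1" c x] by (simp add: scaleC_minus1)

lemma scaleC_minus_right: "c *\<^sub>C (- x) = - (c *\<^sub>C x)"
  by (metis add.right_inverse minus_unique scaleC_0_right scaleC_add_right)

lemma scaleC_diff_right: "c *\<^sub>C (x - y) = c *\<^sub>C x - c *\<^sub>C y"
  using scaleC_add_right[of c x "- y"] by (simp add: scaleC_minus_right)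

lemma scaleC_diff_left: "(c - d) *\<^sub>C x = c *\<^sub>C x - d *\<^sub>C x"
  using scaleC_add_left[of c "- d" x] by (simp add: scaleC_minus_left)

lemma cinner_0_left [simp]: "cinner 0 y = 0"
  using cinner_scaleC_left[of 0 0 y] by simp

lemma cinner_0_right [simp]: "cinner x 0 = 0"
  using cinner_scaleC_right[of x 0 0] by simp

lemma cinner_minus_left: "cinner (- x) y = - cinner x y"
  using cinner_scaleC_left[of "-1" x y] by (simp add: scaleC_minus1)

lemma cinner_minus_right: "cinner x (- y) = - cinner x y"
  using cinner_scaleC_right[of x "-1" y] by (simp add: scaleC_minus1)

lemma cinner_diff_left: "cinner (x - y) z = cinner x z - cinner y z"
  using cinner_add_left[of x "- y" z] by (simp add: cinner_minus_left)

lemma cinner_diff_right: "cinner x (y - z) = cinner x y - cinner x z"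
  using cinner_add_right[of x y "- z"] by (simp add: cinner_minus_right)

section \<open>Projections, the Riesz representation and existence of adjoints\<close>

lemma cinner_eqI: "x = y" if "\<And>z. cinner z x = cinner z y"
proof -
  have "cinner (x - y) (x - y) = 0"
    using that by (simp add: cinner_diff_right)
  then show ?thesis by (simp add: cinner_self)
qed

lemma norm_add_sq: "(norm (x + y))\<^sup>2 = (norm x)\<^sup>2 + (norm y)\<^sup>2 + 2 * Re (cinner x y)"
  for x y :: "'a::complex_hilbert"
proof -
  have "cinner (x + y) (x + y) = cinner x x + cinner y y + (cinner x y + cnj (cinner x y))"
    using cinner_commute[of y x] by (simp add: cinner_add_left cinner_add_right)
  then have "complex_of_real ((norm (x + y))\<^sup>2)
      = complex_of_real ((norm x)\<^sup>2 + (norm y)\<^sup>2 + 2 * Re (cinner x y))"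
    by (simp only: cinner_self complex_add_cnj of_real_add)
  then show ?thesis by (simp only: of_real_eq_iff)
qed

lemma norm_diff_sq: "(norm (x - y))\<^sup>2 = (norm x)\<^sup>2 + (norm y)\<^sup>2 - 2 * Re (cinner x y)"
  for x y :: "'a::complex_hilbert"
  using norm_add_sq[of x "- y"] by (simp add: cinner_minus_right)

text \<open>\<open>c\<close> is the coefficient of the orthogonal projection onto the line of
  \<open>y\<close>. Nonnegativity of the left side is Cauchy-Schwarz; its strict drop unless
  \<open>cinner x y = 0\<close> gives orthogonality to the kernel in the Riesz theorem.\<close>

lemma norm_minus_projection_sq:
  fixes x y :: "'a::complex_hilbert"
  assumes "y \<noteq> 0"
  defines "c \<equiv> cinner x y / complex_of_real ((norm y)\<^sup>2)"
  shows "(norm (x - c *\<^sub>C y))\<^sup>2 = (norm x)\<^sup>2 - (cmod (cinner x y))\<^sup>2 / (norm y)\<^sup>2"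
proof -
  have y: "(norm y)\<^sup>2 \<noteq> 0" using assms by simp
  have "cinner x (c *\<^sub>C y) = complex_of_real ((cmod (cinner x y))\<^sup>2 / (norm y)\<^sup>2)"
    using y by (simp add: cinner_scaleC_right c_def complex_norm_square[symmetric] mult.commute
        flip: of_real_power)
  moreover have "(norm (c *\<^sub>C y))\<^sup>2 = (cmod (cinner x y))\<^sup>2 / (norm y)\<^sup>2"
    using y by (simp add: norm_scaleC c_def power_mult_distrib norm_divide norm_mult power_divide
        power2_eq_square)
  ultimately show ?thesis
    by (simp add: norm_diff_sq)
qed

lemma cauchy_schwarz_cinner: "cmod (cinner x y) \<le> norm x * norm y"
  for x y :: "'a::complex_hilbert"
proof (cases "y = 0")
  case False
  have "0 \<le> (norm x)\<^sup>2 - (cmod (cinner x y))\<^sup>2 / (norm y)\<^sup>2"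
    unfolding norm_minus_projection_sq[OF False, of x, symmetric] by simp
  then have "(cmod (cinner x y))\<^sup>2 \<le> (norm x * norm y)\<^sup>2"
    using False by (simp add: field_simps)
  then show ?thesis by (rule power2_le_imp_le) simp
qed simp

text \<open>The representing vector is a multiple of the point \<open>z\<close> of least norm on the
  affine hyperplane \<open>f x = 1\<close>: minimality makes \<open>z\<close> orthogonal to the
  kernel of \<open>f\<close>, and \<open>x - f x *\<^sub>C z\<close> lies in that kernel.\<close>

lemma riesz_representation:
  fixes f :: "'a::complex_hilbert \<Rightarrow> complex"
  assumes add: "\<And>x y. f (x + y) = f x + f y"
    and scale: "\<And>c x. f (c *\<^sub>C x) = c * f x"
    and bdd: "\<And>x. cmod (f x) \<le> K * norm x"
  shows "\<exists>y. \<forall>x. f x = cinner x y"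
proof (cases "\<forall>x. f x = 0")
  case True
  then show ?thesis by (intro exI[of _ 0]) simp
next
  case False
  then obtain u where u: "f u \<noteq> 0" by blast
  define C where "C = {x. f x = 1}"
  have "(1 / f u) *\<^sub>C u \<in> C" using u by (simp add: C_def scale)
  then have C: "C \<noteq> {}" by blast
  define d where "d = Inf (norm ` C)"
  have d_le: "d \<le> norm x" if "x \<in> C" for x
    unfolding d_def using that by (intro cInf_lower) (auto intro: bdd_belowI[of _ 0])
  have d0: "0 \<le> d"
    unfolding d_def using C by (intro cInf_greatest) auto
  have f_minus: "f (x - y) = f x - f y" for x y
    using add[of "x - y" y] by simp
  have "\<exists>x\<in>C. norm x < d + 1 / real (Suc n)" for n
  proof -
    have "Inf (norm ` C) < d + 1 / real (Suc n)" by (simp add: d_def)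
    from cInf_lessD[OF _ this] C show ?thesis by auto
  qed
  then obtain X where XC: "\<And>n. X n \<in> C" and X: "\<And>n. norm (X n) < d + 1 / real (Suc n)"
    by metis
  have nX: "(\<lambda>n. norm (X n)) \<longlonglongrightarrow> d"
  proof (rule tendsto_sandwich[of "\<lambda>_. d" _ _ "\<lambda>n. d + 1 / real (Suc n)"])
    have "(\<lambda>n. 1 / real (Suc n)) \<longlonglongrightarrow> 0" by (rule LIMSEQ_Suc[OF lim_1_over_n])
    from tendsto_add[OF tendsto_const[of d] this]
    show "(\<lambda>n. d + 1 / real (Suc n)) \<longlonglongrightarrow> d" by simp
  qed (use XC d_le X in \<open>auto intro!: always_eventually less_imp_le\<close>)
  \<comment> \<open>Parallelogram law: the midpoint stays in \<open>C\<close>, so its norm is at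
    least \<open>d\<close>. This makes the minimizing sequence Cauchy.\<close>
  have par: "(norm (x - y))\<^sup>2 \<le> 2 * ((norm x)\<^sup>2 - d\<^sup>2) + 2 * ((norm y)\<^sup>2 - d\<^sup>2)"
    if "x \<in> C" "y \<in> C" for x y
  proof -
    have "(1/2) *\<^sub>C (x + y) \<in> C" using that by (simp add: C_def scale add)
    from d_le[OF this] have "2 * d \<le> norm (x + y)" by (simp add: norm_scaleC norm_divide)
    then have "(2 * d)\<^sup>2 \<le> (norm (x + y))\<^sup>2" using d0 by (intro power_mono) auto
    then show ?thesis using norm_add_sq[of x y] norm_diff_sq[of x y] by (simp add: power2_eq_square)
  qed
  have "Cauchy X"
  proof (rule metric_CauchyI)
    fix e :: real assume e: "0 < e"
    have "(\<lambda>n. (norm (X n))\<^sup>2 - d\<^sup>2) \<longlonglongrightarrow> d\<^sup>2 - d\<^sup>2"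
      by (intro tendsto_intros nX)
    then have "\<forall>\<^sub>F n in sequentially. (norm (X n))\<^sup>2 - d\<^sup>2 < e\<^sup>2 / 4"
      by (rule order_tendstoD) (use e in auto)
    then obtain M where M: "\<And>n. n \<ge> M \<Longrightarrow> (norm (X n))\<^sup>2 - d\<^sup>2 < e\<^sup>2 / 4"
      by (auto simp: eventually_sequentially)
    show "\<exists>M. \<forall>m\<ge>M. \<forall>n\<ge>M. dist (X m) (X n) < e"
    proof (intro exI allI impI)
      fix m n assume "M \<le> m" "M \<le> n"
      then have "(norm (X m - X n))\<^sup>2 < e\<^sup>2"
        using par[OF XC XC, of m n] M[of m] M[of n] by simp
      then show "dist (X m) (X n) < e"
        unfolding dist_norm by (rule power2_less_imp_less) (use e in simp)
    qed
  qed
  then obtain z where z: "X \<longlonglongrightarrow> z"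
    using Cauchy_convergent_iff convergent_def by blast
  have nz: "norm z = d"
    using LIMSEQ_unique[OF tendsto_norm[OF z] nX] .
  have "(\<lambda>n. f (X n)) \<longlonglongrightarrow> f z"
  proof (rule Lim_null_comparison[THEN LIM_zero_cancel])
    show "\<forall>\<^sub>F n in sequentially. norm (f (X n) - f z) \<le> K * norm (X n - z)"
      using bdd by (simp flip: f_minus)
    show "(\<lambda>n. K * norm (X n - z)) \<longlonglongrightarrow> 0"
      using tendsto_mult_left[OF tendsto_norm[OF LIM_zero[OF z]], of K] by simp
  qed
  moreover have "f (X n) = 1" for n using XC by (simp add: C_def)
  ultimately have fz: "f z = 1" by (simp add: LIMSEQ_const_iff)
  then have z0: "z \<noteq> 0" using scale[of 0 0] by auto
  have orth: "cinner z w = 0" if w: "f w = 0" for w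
  proof (cases "w = 0")
    case False
    define c where "c = cinner z w / complex_of_real ((norm w)\<^sup>2)"
    have "z - c *\<^sub>C w \<in> C" by (simp add: C_def f_minus scale w fz)
    then have "(norm z)\<^sup>2 \<le> (norm (z - c *\<^sub>C w))\<^sup>2"
      using d_le nz by (intro power_mono) auto
    also have "\<dots> = (norm z)\<^sup>2 - (cmod (cinner z w))\<^sup>2 / (norm w)\<^sup>2"
      unfolding c_def by (rule norm_minus_projection_sq[OF False])
    finally show ?thesis using False by (simp add: divide_le_0_iff)
  qed simp
  have "f x = cinner x ((1 / complex_of_real ((norm z)\<^sup>2)) *\<^sub>C z)" for x
  proof -
    have "cinner z (x - f x *\<^sub>C z) = 0" by (rule orth) (simp add: f_minus scale fz)
    then have "cinner (x - f x *\<^sub>C z) z = 0" using cinner_commute[of _ z] by simp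
    then have "cinner x z = f x * complex_of_real ((norm z)\<^sup>2)"
      by (simp add: cinner_diff_left cinner_scaleC_left cinner_self)
    then show ?thesis using z0 by (simp add: cinner_scaleC_right)
  qed
  then show ?thesis by blast
qed

text \<open>Gives the definite description in \<open>adj\<close> a witness. Riesz is applied for
  each fixed \<open>y\<close>; testing the adjoint relation at \<open>x = S y\<close> bounds
  \<open>S\<close>.\<close>

lemma adjoint_exists:
  fixes T :: "'a::complex_hilbert \<Rightarrow>\<^sub>L 'a"
  assumes T: "T \<in> bounded_ops"
  shows "\<exists>S\<in>bounded_ops. \<forall>x y. cinner (blinfun_apply T x) y = cinner x (blinfun_apply S y)"
proof -
  have "\<exists>w. \<forall>x. cinner (T x) y = cinner x w" for y
  proof (rule riesz_representation)
    show "cmod (cinner (T x) y) \<le> norm T * norm y * norm x" for x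
      using order_trans[OF cauchy_schwarz_cinner mult_right_mono[OF norm_blinfun]]
      by (simp add: mult.assoc mult.commute[of "norm y"])
  qed (use T in \<open>auto simp: blinfun.add_right cinner_add_left bounded_ops_def cinner_scaleC_left\<close>)
  then obtain S where S: "\<And>x y. cinner (T x) y = cinner x (S y)" by metis
  have add: "S (x + y) = S x + S y" for x y
    by (rule cinner_eqI) (simp add: cinner_add_right flip: S)
  have scale: "S (c *\<^sub>C x) = c *\<^sub>C S x" for c x
    by (rule cinner_eqI) (simp add: cinner_scaleC_right flip: S)
  have "norm (S y) \<le> norm y * norm T" for y
  proof (cases "S y = 0")
    case False
    have "(norm (S y))\<^sup>2 = cmod (cinner (S y) (S y))" by (simp add: cinner_self norm_power)
    also have "\<dots> = cmod (cinner (T (S y)) y)" by (simp add: S)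
    also have "\<dots> \<le> norm T * norm (S y) * norm y"
      by (rule order_trans[OF cauchy_schwarz_cinner mult_right_mono[OF norm_blinfun]]) simp
    finally show ?thesis using False by (simp add: power2_eq_square mult.commute)
  qed simp
  then have "bounded_linear S"
  proof (intro bounded_linear_intro[where K = "norm T"])
    show "S (r *\<^sub>R x) = r *\<^sub>R S x" for r x
      by (subst (1 2) scaleR_scaleC) (rule scale)
  qed (rule add)
  then have "blinfun_apply (Blinfun S) = S" by (rule bounded_linear_Blinfun_apply)
  then show ?thesis
    by (intro bexI[of _ "Blinfun S"]) (auto simp: S bounded_ops_def scale)
qed

lemma adj_eqI:
  assumes "S \<in> bounded_ops" "\<And>x y. cinner (blinfun_apply T x) y = cinner x (blinfun_apply S y)"
  shows "adj T = S"
  unfolding adj_def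
proof (rule the_equality)
  fix S' assume "S' \<in> bounded_ops
    \<and> (\<forall>x y. cinner (blinfun_apply T x) y = cinner x (blinfun_apply S' y))"
  then have "cinner z (blinfun_apply S' y) = cinner z (blinfun_apply S y)" for y z
    using assms(2) by simp
  then show "S' = S" by (rule blinfun_eqI[OF cinner_eqI])
qed (use assms in auto)

lemma
  assumes "T \<in> bounded_ops"
  shows adj_bounded_ops: "adj T \<in> bounded_ops"
    and cinner_adj: "cinner (blinfun_apply T x) y = cinner x (blinfun_apply (adj T) y)"
proof -
  obtain S where S: "S \<in> bounded_ops"
    "\<forall>x y. cinner (blinfun_apply T x) y = cinner x (blinfun_apply S y)"
    using adjoint_exists[OF assms] by blast
  then have "adj T = S" by (intro adj_eqI) auto
  then show "adj T \<in> bounded_ops"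
    "cinner (blinfun_apply T x) y = cinner x (blinfun_apply (adj T) y)" using S by auto
qed

lemma apply_op_scaleC [simp]: "blinfun_apply (op_scaleC c T) x = c *\<^sub>C blinfun_apply T x"
  by (simp add: op_scaleC.rep_eq)

lemma bounded_ops_scaleC: "T \<in> bounded_ops \<Longrightarrow> blinfun_apply T (c *\<^sub>C x) = c *\<^sub>C blinfun_apply T x"
  by (simp add: bounded_ops_def)

lemma closed_bounded_ops: "closed (bounded_ops :: ('a::complex_hilbert \<Rightarrow>\<^sub>L 'a) set)"
proof -
  have bl: "bounded_linear (\<lambda>x::'a. c *\<^sub>C x)" for c
    by (rule bounded_linear_intro[where K = "cmod c"])
      (simp_all add: scaleC_add_right scaleR_scaleC scaleC_scaleC norm_scaleC mult.commute)
  have "closed {T :: 'a \<Rightarrow>\<^sub>L 'a. T (c *\<^sub>C x) = c *\<^sub>C T x}" for c x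
    by (intro closed_Collect_eq linear_continuous_on bounded_linear_apply_blinfun
        bounded_linear_compose[OF bl])
  then show ?thesis
    unfolding bounded_ops_def by (intro closed_Collect_all)
qed

section \<open>The algebra of bounded operators\<close>

text \<open>As a type, B(H) carries ring operations, powers and series, and the adjoint becomes a
  total involution. For a map outside \<open>bounded_ops\<close> no operator satisfies the
  description in \<open>adj\<close>.\<close>

typedef (overloaded) 'a bop = "bounded_ops :: ('a::complex_hilbert \<Rightarrow>\<^sub>L 'a) set"
  morphisms bl_of Bop
  by (rule exI[of _ 0]) (simp add: bounded_ops_def)

setup_lifting type_definition_bop

lift_definition ap :: "'a::complex_hilbert bop \<Rightarrow> 'a \<Rightarrow> 'a" is blinfun_apply .

text \<open>\<open>norm 1 = 1\<close> fails on the zero space, which is why the unit enters through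
  \<open>monoid_mult\<close> alone.\<close>

instantiation bop :: (complex_hilbert) "{real_normed_algebra, monoid_mult}"
begin

lift_definition zero_bop :: "'a bop" is 0 by (simp add: bounded_ops_def)

lift_definition one_bop :: "'a bop" is id_blinfun by (simp add: bounded_ops_def)

lift_definition plus_bop :: "'a bop \<Rightarrow> 'a bop \<Rightarrow> 'a bop" is "(+)"
  by (simp add: bounded_ops_def blinfun.add_left scaleC_add_right)

lift_definition minus_bop :: "'a bop \<Rightarrow> 'a bop \<Rightarrow> 'a bop" is "(-)"
  by (simp add: bounded_ops_def blinfun.diff_left scaleC_diff_right)

lift_definition uminus_bop :: "'a bop \<Rightarrow> 'a bop" is uminus
  by (simp add: bounded_ops_def blinfun.minus_left scaleC_minus_right)

lift_definition times_bop :: "'a bop \<Rightarrow> 'a bop \<Rightarrow> 'a bop" is "(o\<^sub>L)"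
  by (simp add: bounded_ops_def)

lift_definition scaleR_bop :: "real \<Rightarrow> 'a bop \<Rightarrow> 'a bop" is "(*\<^sub>R)"
  by (simp add: bounded_ops_def blinfun.scaleR_left scaleR_scaleC scaleC_scaleC mult.commute)

lift_definition norm_bop :: "'a bop \<Rightarrow> real" is norm .

definition dist_bop :: "'a bop \<Rightarrow> 'a bop \<Rightarrow> real"
  where "dist_bop S T = norm (S - T)"

definition uniformity_bop :: "('a bop \<times> 'a bop) filter"
  where "uniformity_bop = (INF e\<in>{0<..}. principal {(x, y). dist x y < e})"

definition open_bop :: "'a bop set \<Rightarrow> bool"
  where "open_bop U \<longleftrightarrow> (\<forall>x\<in>U. \<forall>\<^sub>F (x', y) in uniformity. x' = x \<longrightarrow> y \<in> U)"

definition sgn_bop :: "'a bop \<Rightarrow> 'a bop"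
  where "sgn_bop T = scaleR (inverse (norm T)) T"

instance
proof
  fix a b c :: "'a bop" and r s :: real and U :: "'a bop set"
  show "a + b + c = a + (b + c)" by transfer simp
  show "a + b = b + a" by transfer simp
  show "0 + a = a" by transfer simp
  show "- a + a = 0" by transfer simp
  show "a - b = a + - b" by transfer simp
  show "r *\<^sub>R (a + b) = r *\<^sub>R a + r *\<^sub>R b" by transfer (simp add: scaleR_add_right)
  show "(r + s) *\<^sub>R a = r *\<^sub>R a + s *\<^sub>R a" by transfer (simp add: scaleR_add_left)
  show "r *\<^sub>R s *\<^sub>R a = (r * s) *\<^sub>R a" by transfer simp
  show "1 *\<^sub>R a = a" by transfer simp
  show "a * b * c = a * (b * c)" by transfer (simp add: blinfun_eqI)
  show "(a + b) * c = a * c + b * c"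
    by transfer (simp add: blinfun_eqI blinfun.add_left)
  show "a * (b + c) = a * b + a * c"
    by transfer (simp add: blinfun_eqI blinfun.add_left blinfun.add_right)
  show "r *\<^sub>R a * b = r *\<^sub>R (a * b)"
    by transfer (simp add: blinfun_eqI blinfun.scaleR_left)
  show "a * r *\<^sub>R b = r *\<^sub>R (a * b)"
    by transfer (simp add: blinfun_eqI blinfun.scaleR_left blinfun.scaleR_right)
  show "1 * a = a" "a * 1 = a" by (transfer, simp add: blinfun_eqI)+
  show "dist a b = norm (a - b)" by (simp add: dist_bop_def)
  show "uniformity = (INF e\<in>{0<..}. principal {(x, y :: 'a bop). dist x y < e})"
    by (simp add: uniformity_bop_def)
  show "open U \<longleftrightarrow> (\<forall>x\<in>U. \<forall>\<^sub>F (x', y) in uniformity. x' = x \<longrightarrow> y \<in> U)"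
    by (simp add: open_bop_def)
  show "sgn a = inverse (norm a) *\<^sub>R a" by (simp add: sgn_bop_def)
  show "norm a = 0 \<longleftrightarrow> a = 0" by transfer simp
  show "norm (a + b) \<le> norm a + norm b" by transfer (rule norm_triangle_ineq)
  show "norm (r *\<^sub>R a) = \<bar>r\<bar> * norm a" by transfer simp
  show "norm (a * b) \<le> norm a * norm b" by transfer (rule norm_blinfun_compose)
qed

end

lemma dist_bl_of: "dist (bl_of S) (bl_of T) = dist S T"
  by (simp add: dist_norm norm_bop.rep_eq minus_bop.rep_eq)

instance bop :: (complex_hilbert) banach
proof
  fix X :: "nat \<Rightarrow> 'a bop" assume "Cauchy X"
  then have "Cauchy (\<lambda>n. bl_of (X n))" by (simp add: Cauchy_def dist_bl_of)
  then obtain L where L: "(\<lambda>n. bl_of (X n)) \<longlonglongrightarrow> L"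
    using Cauchy_convergent_iff convergent_def by blast
  have "L \<in> bounded_ops"
    by (rule closed_sequentially[OF closed_bounded_ops _ L]) (rule bl_of)
  then have "bl_of (Bop L) = L" by (rule Bop_inverse)
  then have "X \<longlonglongrightarrow> Bop L"
    using L by (simp add: lim_sequentially flip: dist_bl_of)
  then show "convergent X" by (auto simp: convergent_def)
qed

lemma continuous_on_bl_of: "continuous_on U bl_of"
  by (simp add: continuous_on_iff dist_bl_of) blast

section \<open>Adjoints, scalars and the C*-identity\<close>

lift_definition star :: "'a::complex_hilbert bop \<Rightarrow> 'a bop" is adj
  by (rule adj_bounded_ops)

text \<open>Scalars are central elements of the ring, so complex multiples are ordinary
  products.\<close>

lift_definition sc :: "complex \<Rightarrow> 'a::complex_hilbert bop" is "\<lambda>c. op_scaleC c id_blinfun"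
  by (simp add: bounded_ops_def scaleC_scaleC mult.commute)

lemma bop_eqI: "S = T" if "\<And>x. ap S x = ap T x"
  using that by transfer (rule blinfun_eqI)

lemma ap_simps [simp]:
  "ap 0 x = 0" "ap 1 x = x" "ap (S + T) x = ap S x + ap T x" "ap (S - T) x = ap S x - ap T x"
  "ap (- S) x = - ap S x" "ap (S * T) x = ap S (ap T x)" "ap (sc c) x = c *\<^sub>C x"
  by (transfer, simp add: blinfun.add_left blinfun.diff_left blinfun.minus_left)+

lemma ap_add: "ap T (x + y) = ap T x + ap T y"
  by transfer (rule blinfun.add_right)

lemma ap_diff: "ap T (x - y) = ap T x - ap T y"
  by transfer (rule blinfun.diff_right)

lemma ap_0_right [simp]: "ap T 0 = 0"
  by transfer (rule blinfun.zero_right)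

lemma ap_scaleC: "ap T (c *\<^sub>C x) = c *\<^sub>C ap T x"
  by transfer (simp add: bounded_ops_def)

lemma norm_ap: "norm (ap T x) \<le> norm T * norm x"
  by transfer (rule norm_blinfun)

lemma norm_bop_bound: "0 \<le> b \<Longrightarrow> (\<And>x. norm (ap T x) \<le> b * norm x) \<Longrightarrow> norm T \<le> b"
  by transfer (rule norm_blinfun_bound)

lemma cinner_ap: "cinner (ap T x) y = cinner x (ap (star T) y)"
  by transfer (rule cinner_adj)

lemma starI: "star T = S" if "\<And>x y. cinner (ap T x) y = cinner x (ap S y)"
  using that by transfer (rule adj_eqI)

lemma cinner_ap_right: "cinner x (ap T y) = cinner (ap (star T) x) y"
  using cinner_commute[of x "ap T y"] cinner_commute[of "ap (star T) x" y]
  by (simp add: cinner_ap)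

lemma star_star [simp]: "star (star T) = T"
  by (rule starI) (simp flip: cinner_ap_right)

lemma star_mult: "star (S * T) = star T * star S"
  by (rule starI) (simp add: cinner_ap)

lemma star_add: "star (S + T) = star S + star T"
  by (rule starI) (simp add: cinner_add_left cinner_add_right cinner_ap)

lemma star_diff: "star (S - T) = star S - star T"
  by (rule starI) (simp add: cinner_diff_left cinner_diff_right cinner_ap)

lemma star_sc [simp]: "star (sc c) = sc (cnj c)"
  by (rule starI) (simp add: cinner_scaleC_left cinner_scaleC_right)

lemma star_0 [simp]: "star 0 = 0" and star_1 [simp]: "star 1 = 1"
  by (rule starI; simp)+

lemma sc_commute: "T * sc c = sc c * T"
  by (rule bop_eqI) (simp add: ap_scaleC)

lemma sc_add: "sc (c + d) = sc c + sc d"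
  and sc_mult: "sc (c * d) = sc c * sc d" and sc_1 [simp]: "sc 1 = 1" and sc_0 [simp]: "sc 0 = 0"
  by (rule bop_eqI; simp add: scaleC_add_left scaleC_scaleC)+

lemma sc_minus: "sc (- c) = - sc c"
  by (rule bop_eqI) (simp add: scaleC_minus_left)

lemma norm_sc_mult: "norm (sc c * T) = cmod c * norm T"
proof (rule antisym)
  have le: "norm (sc c * T) \<le> cmod c * norm T" for c and T :: "'a bop"
    by (rule norm_bop_bound) (auto simp: norm_scaleC mult.assoc intro!: mult_left_mono norm_ap)
  then show "norm (sc c * T) \<le> cmod c * norm T" .
  show "cmod c * norm T \<le> norm (sc c * T)"
  proof (cases "c = 0")
    case False
    have "T = sc (1 / c) * (sc c * T)" using False by (simp flip: mult.assoc sc_mult)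
    then have "norm T \<le> cmod (1 / c) * norm (sc c * T)" using le by metis
    then show ?thesis using False by (simp add: norm_divide field_simps)
  qed simp
qed

lemma norm_sc_le: "norm (sc c :: 'a::complex_hilbert bop) \<le> cmod c"
  by (rule norm_bop_bound) (simp_all add: norm_scaleC)

text \<open>Cauchy-Schwarz for \<open>cinner x (ap (star T * T) x)\<close> gives \<open>le\<close>.
  Submultiplicativity then yields \<open>norm T \<le> norm (star T)\<close>; the same for
  \<open>star T\<close> makes the adjoint isometric, which closes the remaining inequality.\<close>

lemma norm_star_mult_self: "norm (star T * T) = (norm T)\<^sup>2"
  and norm_star [simp]: "norm (star T) = norm T"
proof -
  have le: "(norm T)\<^sup>2 \<le> norm (star T * T)" for T :: "'a bop"
  proof -
    have "norm T \<le> sqrt (norm (star T * T))"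
    proof (rule norm_bop_bound)
      fix x
      have "(norm (ap T x))\<^sup>2 = cmod (cinner (ap T x) (ap T x))" by (simp add: cinner_self norm_power)
      also have "\<dots> = cmod (cinner x (ap (star T * T) x))" by (simp add: cinner_ap)
      also have "\<dots> \<le> norm x * (norm (star T * T) * norm x)"
        by (rule order_trans[OF cauchy_schwarz_cinner mult_left_mono[OF norm_ap]]) simp
      also have "\<dots> = (sqrt (norm (star T * T)) * norm x)\<^sup>2"
        by (simp add: power_mult_distrib power2_eq_square)
      finally show "norm (ap T x) \<le> sqrt (norm (star T * T)) * norm x"
        by (rule power2_le_imp_le) simp
    qed simp
    then have "(norm T)\<^sup>2 \<le> (sqrt (norm (star T * T)))\<^sup>2" by (rule power_mono) simp
    then show ?thesis by simp
  qed
  have le': "norm T \<le> norm (star T)" for T :: "'a bop"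
  proof (cases "T = 0")
    case False
    have "norm T * norm T \<le> norm (star T) * norm T"
      using order_trans[OF le norm_mult_ineq] by (simp add: power2_eq_square)
    then show ?thesis using False by simp
  qed simp
  from le'[of T] le'[of "star T"] show *: "norm (star T) = norm T" by simp
  show "norm (star T * T) = (norm T)\<^sup>2"
    using le[of T] norm_mult_ineq[of "star T" T] by (simp add: * power2_eq_square)
qed

section \<open>Fuglede's theorem\<close>

lemma power_mult_commuting: "(x * y) ^ n = x ^ n * y ^ n" if "x * y = y * x"
  for x y :: "'a::monoid_mult"
proof (induction n)
  case (Suc n)
  have "y * x ^ n = x ^ n * y" by (rule power_commuting_commutes[symmetric, OF that])
  then have "x * (y * (x ^ n * y ^ n)) = x * (x ^ n * (y * y ^ n))" by (metis mult.assoc)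
  then show ?case by (simp add: Suc mult.assoc)
qed simp

lemma norm_one_bop_le: "norm (1 :: 'a::complex_hilbert bop) \<le> 1"
  using norm_sc_le[of 1] by simp

lemma norm_power_bop_le: "norm (T ^ n) \<le> c ^ n" if "norm T \<le> c" for T :: "'a::complex_hilbert bop"
proof (induction n)
  case (Suc n)
  have "norm (T ^ Suc n) \<le> norm T * norm (T ^ n)" by (simp add: norm_mult_ineq)
  also have "\<dots> \<le> c * c ^ n" using that Suc order_trans[OF norm_ge_zero that] by (intro mult_mono) auto
  finally show ?case by simp
qed (simp add: norm_one_bop_le)

text \<open>The right side is the binomial sum of the left side with each term replaced by its
  norm.\<close>

lemma norm_one_minus_power_le:
  fixes T :: "'a::complex_hilbert bop"
  shows "norm (1 - (1 - T) ^ n) \<le> (1 + norm T) ^ n - 1"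
proof (induction n)
  case (Suc n)
  have T: "norm (1 - T) \<le> 1 + norm T"
    using norm_triangle_ineq4[of 1 T] norm_one_bop_le[where 'a = 'a] by linarith
  have "1 - (1 - T) ^ Suc n = (1 - T) * (1 - (1 - T) ^ n) + T"
    by (simp add: algebra_simps)
  then have "norm (1 - (1 - T) ^ Suc n) \<le> norm (1 - T) * norm (1 - (1 - T) ^ n) + norm T"
    by (metis norm_triangle_le add_right_mono norm_mult_ineq)
  also have "\<dots> \<le> (1 + norm T) * ((1 + norm T) ^ n - 1) + norm T"
    using Suc T by (intro add_right_mono mult_mono) auto
  finally show ?case by (simp add: algebra_simps)
qed simp

text \<open>\<open>(1 + a) (1 - a\<^sup>*)\<close> agrees to first order with the exponential of the skew-adjoint
  \<open>a - a\<^sup>*\<close>, so its powers grow only at second order in \<open>a\<close>. The factors \<open>1 - a\<^sup>*\<close> commute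
  with \<open>N\<close> and almost cancel.\<close>

lemma norm_conjugation_le:
  fixes a N :: "'a::complex_hilbert bop"
  assumes normal: "star a * a = a * star a" and comm: "star a * N = N * star a"
  defines "s \<equiv> norm a"
  shows "norm ((1 + a) ^ n * N * (1 - a) ^ n)
    \<le> norm N * ((1 + s\<^sup>2) ^ (2 * n) + (1 + s) ^ (2 * n) * ((1 + s\<^sup>2) ^ n - 1))"
proof -
  define b where "b = star a"
  note ba = normal[folded b_def] and bN = comm[folded b_def]
  have ba': "b * (a * x) = a * (b * x)" for x by (metis ba mult.assoc)
  define u v where "u = (1 + a) * (1 - b)" and "v = (1 + b) * (1 - a)"
  have s0: "0 \<le> s" by (simp add: s_def)
  have nb: "norm b = s" by (simp add: b_def s_def)
  have nsq: "norm (1 - x * x) \<le> 1 + s\<^sup>2" if "norm x = s" for x :: "'a bop"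
    using norm_triangle_ineq4[of 1 "x * x"] norm_mult_ineq[of x x] norm_one_bop_le[where 'a = 'a] that
    by (simp add: power2_eq_square)
  have su: "star u = v"
    by (simp add: u_def v_def b_def star_mult star_add star_diff)
      (simp add: algebra_simps normal)
  \<comment> \<open>First-order terms cancel, so \<open>u\<close> is unitary up to second order; the
    C*-identity turns this into the bound on \<open>norm u\<close>.\<close>
  have "star u * u = (1 - a * a) * (1 - b * b)"
    unfolding su by (simp add: u_def v_def algebra_simps ba ba')
  then have "(norm u)\<^sup>2 \<le> norm (1 - a * a) * norm (1 - b * b)"
    by (metis norm_star_mult_self norm_mult_ineq)
  also have "\<dots> \<le> (1 + s\<^sup>2) * (1 + s\<^sup>2)"
    using nsq[OF nb] nsq[of a] by (intro mult_mono) (auto simp: s_def)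
  finally have nu: "norm u \<le> 1 + s\<^sup>2"
    by (intro power2_le_imp_le[of "norm u"]) (auto simp: power2_eq_square)
  then have nv: "norm v \<le> 1 + s\<^sup>2" by (simp flip: su)
  have un: "u ^ n = (1 + a) ^ n * (1 - b) ^ n"
    unfolding u_def by (rule power_mult_commuting) (simp add: algebra_simps ba)
  have vn: "v ^ n = (1 + b) ^ n * (1 - a) ^ n"
    unfolding v_def by (rule power_mult_commuting) (simp add: algebra_simps ba)
  have Nb: "(1 - b) ^ n * N = N * (1 - b) ^ n"
    by (rule power_commuting_commutes) (simp add: algebra_simps bN)
  have bb: "(1 - b) ^ n * (1 + b) ^ n = (1 - b * b) ^ n"
    by (subst power_mult_commuting[symmetric]) (simp_all add: algebra_simps)
  have "u ^ n * N * v ^ n = (1 + a) ^ n * ((1 - b) ^ n * N) * (1 + b) ^ n * (1 - a) ^ n"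
    by (simp add: un vn mult.assoc)
  also have "\<dots> = (1 + a) ^ n * N * ((1 - b) ^ n * (1 + b) ^ n) * (1 - a) ^ n"
    unfolding Nb by (simp add: mult.assoc)
  finally have uNv: "u ^ n * N * v ^ n = (1 + a) ^ n * N * (1 - b * b) ^ n * (1 - a) ^ n"
    by (simp only: bb)
  \<comment> \<open>The second summand is the price for \<open>(1 - b * b) ^ n\<close> not being 1.
    For \<open>s\<close> of order 1/n, \<open>(1 + s) ^ (2 * n)\<close> stays bounded while
    \<open>(1 + s\<^sup>2) ^ n - 1\<close> tends to 0.\<close>
  have "(1 + a) ^ n * N * (1 - a) ^ n
      = u ^ n * N * v ^ n + (1 + a) ^ n * N * (1 - (1 - b * b) ^ n) * (1 - a) ^ n"
    unfolding uNv by (simp add: algebra_simps)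
  then have "norm ((1 + a) ^ n * N * (1 - a) ^ n) \<le> norm (u ^ n * N * v ^ n)
      + norm ((1 + a) ^ n * N * (1 - (1 - b * b) ^ n) * (1 - a) ^ n)"
    using norm_triangle_ineq by metis
  also have "norm (u ^ n * N * v ^ n) \<le> (1 + s\<^sup>2) ^ n * norm N * (1 + s\<^sup>2) ^ n"
    using norm_power_bop_le[OF nu, of n] norm_power_bop_le[OF nv, of n]
    by (intro order_trans[OF norm_mult_ineq] mult_mono) auto
  also have "norm ((1 + a) ^ n * N * (1 - (1 - b * b) ^ n) * (1 - a) ^ n)
      \<le> (1 + s) ^ n * norm N * ((1 + s\<^sup>2) ^ n - 1) * (1 + s) ^ n"
  proof -
    have "norm (1 + a) \<le> 1 + s" "norm (1 - a) \<le> 1 + s"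
      using norm_triangle_ineq[of 1 a] norm_triangle_ineq4[of 1 a] norm_one_bop_le[where 'a = 'a]
      by (auto simp: s_def)
    note A = this[THEN norm_power_bop_le, of n]
    have "norm (b * b) \<le> s\<^sup>2"
      using norm_mult_ineq[of b b] by (simp add: nb power2_eq_square)
    then have "norm (1 - (1 - b * b) ^ n) \<le> (1 + s\<^sup>2) ^ n - 1"
      by (intro order_trans[OF norm_one_minus_power_le] diff_right_mono power_mono) auto
    with A s0 show ?thesis
      by (intro order_trans[OF norm_mult_ineq] mult_mono) auto
  qed
  moreover have "z ^ (2 * n) = z ^ n * z ^ n" for z :: real
    by (simp add: mult_2 power_add)
  ultimately show ?thesis by (simp add: algebra_simps)
qed

text \<open>Matrix coefficients make the Liouville argument scalar. Peeling off the outermost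
  factors moves \<open>C\<close> onto \<open>x\<close> and \<open>star C\<close> onto
  \<open>y\<close>, so the induction runs over all \<open>x\<close> and \<open>y\<close>; at 0 each
  peeling adds one commutator to the derivative.\<close>

lemma
  fixes C N :: "'a::complex_hilbert bop" and k :: nat
  defines "f \<equiv> \<lambda>k l x y. cinner (ap ((1 + sc l * C) ^ k * N * (1 - sc l * C) ^ k) x) y"
  shows holomorphic_conjugation: "(\<lambda>l. f k l x y) holomorphic_on UNIV"
    and has_derivative_conjugation:
      "((\<lambda>l. f k l x y) has_field_derivative of_nat k * cinner (ap (C * N - N * C) x) y) (at 0)"
proof -
  have Suc: "f (Suc k) = (\<lambda>l x y. f k l x y - l * f k l (ap C x) y
      + l * (f k l x (ap (star C) y) - l * f k l (ap C x) (ap (star C) y)))" for k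
  proof (intro ext)
    fix l x y
    define X where "X = (1 + sc l * C) ^ k * N * (1 - sc l * C) ^ k"
    have "(1 + sc l * C) ^ Suc k * N * (1 - sc l * C) ^ Suc k
        = (1 + sc l * C) * X * (1 - sc l * C)"
      unfolding X_def by (simp only: power_Suc[of "1 + sc l * C"] power_Suc2[of "1 - sc l * C"] mult.assoc)
    then have "f (Suc k) l x y = cinner (ap ((1 + sc l * C) * X * (1 - sc l * C)) x) y"
      by (simp only: f_def)
    also have "\<dots> = cinner (ap X x) y - l * cinner (ap X (ap C x)) y
      + l * (cinner (ap X x) (ap (star C) y) - l * cinner (ap X (ap C x)) (ap (star C) y))"
      by (simp add: ap_diff ap_scaleC cinner_add_left cinner_diff_left cinner_scaleC_left
          flip: cinner_ap) (simp add: algebra_simps)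
    finally show "f (Suc k) l x y = f k l x y - l * f k l (ap C x) y
      + l * (f k l x (ap (star C) y) - l * f k l (ap C x) (ap (star C) y))"
      by (simp only: X_def f_def)
  qed
  show "(\<lambda>l. f k l x y) holomorphic_on UNIV"
  proof (induction k arbitrary: x y)
    case 0
    show ?case by (simp add: f_def)
  next
    case (Suc k)
    show ?case unfolding \<open>f (Suc k) = _\<close> by (intro holomorphic_intros Suc.IH)
  qed
  show "((\<lambda>l. f k l x y) has_field_derivative of_nat k * cinner (ap (C * N - N * C) x) y) (at 0)"
  proof (induction k arbitrary: x y)
    case 0
    show ?case by (simp add: f_def)
  next
    case (Suc k)
    have "f k 0 x y = cinner (ap N x) y" for x y by (simp add: f_def)
    then show ?case unfolding \<open>f (Suc k) = _\<close>
      by (auto intro!: derivative_eq_intros Suc.IH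
          simp: algebra_simps cinner_add_left cinner_diff_left cinner_ap)
  qed
qed

lemma one_plus_power_le_exp: "(1 + x) ^ n \<le> exp (real n * x)" if "0 \<le> x" for x :: real
  using power_mono[OF exp_ge_add_one_self, of x n] that by (simp flip: exp_of_nat_mult)

text \<open>Cauchy's estimate on the circle of radius \<open>r\<close> bounds a coefficient of the
  commutator \<open>D\<close>. Letting n tend to infinity first removes the growth in
  \<open>r\<close> from the numerator; then \<open>r\<close> tends to infinity.\<close>

theorem fuglede:
  fixes M N :: "'a::complex_hilbert bop"
  assumes normal: "star M * M = M * star M" and comm: "M * N = N * M"
  shows "star M * N = N * star M"
proof -
  define D where "D = star M * N - N * star M"
  \<comment> \<open>Bounds the factor of \<open>norm N\<close> in \<open>norm_conjugation_le\<close>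
    for \<open>s = t / (n + 1)\<close> and exponent \<open>n + 1\<close>, using
    \<open>(1 + x) ^ m \<le> exp (m * x)\<close>. It tends to 1.\<close>
  define E where "E t n = exp (2 * t\<^sup>2 / real (Suc n)) + exp (2 * t) * (exp (t\<^sup>2 / real (Suc n)) - 1)"
    for t :: real and n :: nat
  have bound: "cmod (cinner (ap D x) y) \<le> norm N * E (r * norm M) n * norm x * norm y / r"
    if r: "0 < r" for r x y n
  proof -
    \<comment> \<open>The scaling compensates the factor \<open>n + 1\<close> from differentiating
      the power, so the derivative at 0 is \<open>cinner (ap D x) y\<close> for every n.\<close>
    define C where "C = sc (1 / of_nat (Suc n)) * star M"
    define g where "g l = (1 + sc l * C) ^ Suc n * N * (1 - sc l * C) ^ Suc n" for l
    define t where "t = r * norm M"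
    have nC: "star C = sc (1 / of_nat (Suc n)) * M"
      by (simp add: C_def star_mult sc_commute)
    have ng: "norm (g l) \<le> norm N * E t n" if l: "cmod l = r" for l
    proof -
      define a where "a = sc l * C"
      define s where "s = t / real (Suc n)"
      have ns: "norm a = s"
        by (simp add: a_def C_def s_def t_def norm_sc_mult l norm_divide del: of_nat_Suc)
      have sa: "star a = sc (cnj (l / of_nat (Suc n))) * M"
      proof -
        have "star a = sc (cnj l) * star C" by (simp add: a_def star_mult sc_commute)
        then show ?thesis by (simp add: nC flip: mult.assoc sc_mult)
      qed
      have a: "a = sc (l / of_nat (Suc n)) * star M"
        by (simp add: a_def C_def sc_mult[symmetric] mult.assoc[symmetric])
      have scomm: "sc c * X * (sc d * Y) = sc (c * d) * (X * Y)" for c d and X Y :: "'a bop"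
      proof -
        have "sc c * X * (sc d * Y) = sc c * (X * sc d) * Y" by (simp add: mult.assoc)
        then show ?thesis by (simp add: sc_commute[of X] mult.assoc) (simp flip: mult.assoc add: sc_mult)
      qed
      have "star a * a = a * star a"
        unfolding sa unfolding a by (simp add: scomm normal mult.commute)
      moreover have "star a * N = N * star a"
        unfolding sa using comm by (simp add: mult.assoc sc_commute[of N]) (simp flip: mult.assoc add: sc_commute[of N])
      ultimately have "norm (g l) \<le> norm N * ((1 + s\<^sup>2) ^ (2 * Suc n)
          + (1 + s) ^ (2 * Suc n) * ((1 + s\<^sup>2) ^ Suc n - 1))"
        unfolding g_def a_def[symmetric] ns[symmetric] by (rule norm_conjugation_le)
      also have "\<dots> \<le> norm N * E t n"
      proof -
        have s0: "0 \<le> s" using r by (simp add: s_def t_def)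
        have 1: "real (Suc n) * s\<^sup>2 = t\<^sup>2 / real (Suc n)"
          by (simp add: s_def power2_eq_square del: of_nat_Suc)
        have 2: "real (Suc n) * s = t"
          by (simp add: s_def del: of_nat_Suc)
        have "(1 + s\<^sup>2) ^ Suc n \<le> exp (t\<^sup>2 / real (Suc n))"
          using one_plus_power_le_exp[of "s\<^sup>2" "Suc n"] unfolding 1 by simp
        moreover have "(1 + s\<^sup>2) ^ (2 * Suc n) \<le> exp (2 * t\<^sup>2 / real (Suc n))"
          using one_plus_power_le_exp[of "s\<^sup>2" "2 * Suc n"] 1
          by (simp add: mult.assoc del: of_nat_Suc power_Suc mult_Suc_right)
        moreover have "(1 + s) ^ (2 * Suc n) \<le> exp (2 * t)"
          using one_plus_power_le_exp[of "s" "2 * Suc n"] 2 s0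
          by (simp add: mult.assoc del: of_nat_Suc power_Suc mult_Suc_right)
        moreover have "1 \<le> (1 + s\<^sup>2) ^ Suc n" by (rule one_le_power) simp
        ultimately show ?thesis
          unfolding E_def by (intro mult_left_mono add_mono mult_mono) auto
      qed
      finally show ?thesis .
    qed
    define h where "h = (\<lambda>l. cinner (ap (g l) x) y)"
    have hol: "h holomorphic_on UNIV"
      unfolding h_def g_def by (rule holomorphic_conjugation)
    have "C * N - N * C = sc (1 / of_nat (Suc n)) * D"
      by (simp add: C_def D_def right_diff_distrib) (simp flip: mult.assoc add: sc_commute[of N])
    then have "(h has_field_derivative cinner (ap D x) y) (at 0)"
      using has_derivative_conjugation[where k = "Suc n" and C = C and N = N and x = x and y = y]
      by (simp add: h_def g_def cinner_scaleC_left del: of_nat_Suc power_Suc)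
    then have "cinner (ap D x) y = (deriv ^^ 1) h 0"
      by (simp add: DERIV_imp_deriv)
    also have "cmod \<dots> \<le> fact 1 * (norm N * E t n * norm x * norm y) / r ^ 1"
    proof (rule Cauchy_inequality)
      show "h holomorphic_on ball 0 r" using hol by (rule holomorphic_on_subset) simp
      show "continuous_on (cball 0 r) h"
        using holomorphic_on_imp_continuous_on[OF hol] by (rule continuous_on_subset) simp
      fix l :: complex assume "norm (0 - l) = r"
      then have l: "cmod l = r" by simp
      have "cmod (h l) \<le> norm (g l) * norm x * norm y"
        unfolding h_def by (rule order_trans[OF cauchy_schwarz_cinner mult_right_mono[OF norm_ap]]) simp
      also have "\<dots> \<le> norm N * E t n * norm x * norm y"
        by (intro mult_right_mono ng[OF l]) auto
      finally show "cmod (h l) \<le> norm N * E t n * norm x * norm y" .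
    qed (rule r)
    finally show ?thesis by (simp add: t_def)
  qed
  have E: "E t \<longlonglongrightarrow> 1" for t
  proof -
    have "(\<lambda>n. c / real (Suc n)) \<longlonglongrightarrow> 0" for c
      using tendsto_mult[OF tendsto_const[of c] LIMSEQ_Suc[OF lim_1_over_n]] by simp
    then have "(\<lambda>n. exp (c / real (Suc n))) \<longlonglongrightarrow> exp 0" for c
      by (intro tendsto_exp)
    from tendsto_add[OF this tendsto_mult[OF tendsto_const[of "exp (2 * t)"]
          tendsto_diff[OF this tendsto_const[of 1]]], of "2 * t\<^sup>2" "t\<^sup>2"]
    show ?thesis by (simp add: E_def[abs_def])
  qed
  have bound': "cmod (cinner (ap D x) y) \<le> norm N * norm x * norm y / r" if r: "0 < r" for r x y
  proof (rule LIMSEQ_le_const)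
    have "(\<lambda>n. norm N * E (r * norm M) n * norm x * norm y / r)
        \<longlonglongrightarrow> norm N * 1 * norm x * norm y / r"
      using r by (intro tendsto_intros E) auto
    then show "(\<lambda>n. norm N * E (r * norm M) n * norm x * norm y / r)
        \<longlonglongrightarrow> norm N * norm x * norm y / r" by simp
  qed (use bound[OF r] in blast)
  have "cinner (ap D x) y = 0" for x y
  proof -
    have "(\<lambda>n. (norm N * norm x * norm y) * (1 / real (Suc n))) \<longlonglongrightarrow> (norm N * norm x * norm y) * 0"
      by (intro tendsto_mult tendsto_const LIMSEQ_Suc[OF lim_1_over_n])
    then have "cmod (cinner (ap D x) y) \<le> (norm N * norm x * norm y) * 0"
      by (rule LIMSEQ_le_const) (use bound'[of "real (Suc _)"] in auto)
    then show ?thesis by simp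
  qed
  then have "cinner (ap D x) (ap D x) = 0" for x by simp
  then have "D = 0" by (intro bop_eqI) (simp add: cinner_self)
  then show ?thesis by (simp add: D_def)
qed

section \<open>Characters from joint approximate eigenvectors\<close>

definition near_null :: "'a::complex_hilbert bop set \<Rightarrow> real \<Rightarrow> 'a set"
  where "near_null K e = {x. x \<noteq> 0 \<and> (\<forall>B\<in>K. norm (ap B x) \<le> e * norm x)}"

text \<open>Only finitely many operators are tested at a time, so the property passes to unions of
  chains, as Zorn's lemma requires.\<close>

definition approx_null :: "'a::complex_hilbert bop set \<Rightarrow> bool"
  where "approx_null G \<longleftrightarrow> (\<forall>K\<subseteq>G. finite K \<longrightarrow> (\<forall>e>0. near_null K e \<noteq> {}))"

text \<open>For \<open>approx_null G\<close>, the infimum of this set is the limit superior of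
  \<open>norm (ap R x) / norm x\<close> along the filter generated by the sets
  \<open>near_null K e\<close> with finite \<open>K \<subseteq> G\<close>.\<close>

definition bounds_near :: "'a::complex_hilbert bop set \<Rightarrow> 'a bop \<Rightarrow> real set"
  where "bounds_near G R =
    {t. \<exists>K\<subseteq>G. finite K \<and> (\<exists>e>0. \<forall>x\<in>near_null K e. norm (ap R x) \<le> t * norm x)}"

lemma near_null_mono: "K \<subseteq> K' \<Longrightarrow> e' \<le> e \<Longrightarrow> near_null K' e' \<subseteq> near_null K e"
  unfolding near_null_def by (auto intro!: order_trans[OF _ mult_right_mono[of e' e]])

text \<open>\<open>B\<close> commutes past \<open>S\<close>, which costs a factor
  \<open>norm S\<close>; the lower bound \<open>c\<close> converts \<open>norm x\<close> back into
  \<open>norm (ap S x)\<close>. The tolerance thus worsens by \<open>norm S / c\<close>, which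
  \<open>he\<close> absorbs.\<close>

lemma near_null_ap:
  assumes x: "x \<in> near_null K h" and comm: "\<And>B. B \<in> K \<Longrightarrow> B * S = S * B"
    and c: "0 < c" "c * norm x \<le> norm (ap S x)" and he: "norm S * h \<le> c * e" and e: "0 \<le> e"
  shows "ap S x \<in> near_null K e"
proof -
  have "norm (ap B (ap S x)) \<le> e * norm (ap S x)" if B: "B \<in> K" for B
  proof -
    have "ap B (ap S x) = ap S (ap B x)"
      using comm[OF B] by (metis ap_simps(6))
    then have "norm (ap B (ap S x)) \<le> norm S * norm (ap B x)"
      using norm_ap by metis
    also have "\<dots> \<le> norm S * (h * norm x)"
      using x B by (intro mult_left_mono) (auto simp: near_null_def)
    also have "\<dots> \<le> (c * e) * norm x"
      using mult_right_mono[OF he, of "norm x"] by (simp add: mult.assoc)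
    also have "\<dots> \<le> e * norm (ap S x)"
      using mult_left_mono[OF c(2) e] by (simp add: mult_ac)
    finally show ?thesis .
  qed
  moreover have "ap S x \<noteq> 0"
    using c x by (auto simp: near_null_def mult_le_0_iff)
  ultimately show ?thesis by (auto simp: near_null_def)
qed

lemma not_approx_null_insert:
  assumes "\<not> approx_null (insert T G)"
  obtains K e where "K \<subseteq> G" "finite K" "0 < e"
    "\<And>x. x \<in> near_null K e \<Longrightarrow> e * norm x < norm (ap T x)"
proof -
  obtain K e where K: "K \<subseteq> insert T G" "finite K" "0 < e" "near_null K e = {}"
    using assms unfolding approx_null_def by blast
  show ?thesis
  proof
    show "K - {T} \<subseteq> G" "finite (K - {T})" "0 < e" using K by auto
    fix x assume "x \<in> near_null (K - {T}) e"
    moreover have "x \<notin> near_null K e" using K by blast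
    ultimately show "e * norm x < norm (ap T x)"
      by (auto simp: near_null_def not_le) (metis DiffI leD singletonD)
  qed
qed

lemma norm_in_bounds_near: "norm R \<in> bounds_near G R"
proof -
  have "\<exists>e>0. \<forall>x\<in>near_null {} e. norm (ap R x) \<le> norm R * norm x"
    using zero_less_one norm_ap by blast
  then show ?thesis unfolding bounds_near_def by blast
qed

lemma bounds_near_nonneg: "0 \<le> t" if G: "approx_null G" and t: "t \<in> bounds_near G R"
proof -
  obtain K e where K: "K \<subseteq> G" "finite K" "0 < e"
    "\<forall>x\<in>near_null K e. norm (ap R x) \<le> t * norm x" using t by (auto simp: bounds_near_def)
  then obtain x where "x \<in> near_null K e" using G unfolding approx_null_def by blast
  with K(4) have "0 \<le> t * norm x" "x \<noteq> 0" using order_trans[OF norm_ge_zero] by (auto simp: near_null_def)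
  then show "0 \<le> t" by (simp add: zero_le_mult_iff)
qed

text \<open>On vectors nearly annihilated by \<open>G\<close>, \<open>r\<close> is the largest possible growth factor of \<open>R\<close>,
  and a vector \<open>x\<close> where it is nearly attained satisfies \<open>R\<^sup>2 x \<approx> r\<^sup>2 x\<close>. Then either
  \<open>(R + r) x \<approx> 0\<close>, or \<open>(R + r) x\<close> is an approximate eigenvector for \<open>r\<close>.\<close>

lemma approx_null_extend:
  fixes G :: "'a::complex_hilbert bop set"
  assumes G: "approx_null G" and comm: "\<And>B. B \<in> G \<Longrightarrow> B * R = R * B" and sa: "star R = R"
  defines "r \<equiv> Inf (bounds_near G R)"
  shows "approx_null (insert (R - sc r) G) \<or> approx_null (insert (R + sc r) G)"
proof (rule ccontr)
  assume "\<not> ?thesis"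
  then have n1: "\<not> approx_null (insert (R - sc r) G)" and n2: "\<not> approx_null (insert (R + sc r) G)"
    by auto
  obtain K1 e1 where 1: "K1 \<subseteq> G" "finite K1" "0 < e1"
    "\<And>x. x \<in> near_null K1 e1 \<Longrightarrow> e1 * norm x < norm (ap (R - sc r) x)"
    using not_approx_null_insert[OF n1] by blast
  obtain K2 e2 where 2: "K2 \<subseteq> G" "finite K2" "0 < e2"
    "\<And>x. x \<in> near_null K2 e2 \<Longrightarrow> e2 * norm x < norm (ap (R + sc r) x)"
    using not_approx_null_insert[OF n2] by blast
  define K0 e0 where "K0 = K1 \<union> K2" and "e0 = min e1 e2"
  have K0: "K0 \<subseteq> G" "finite K0" and e0: "0 < e0" using 1 2 by (auto simp: K0_def e0_def)
  have minus: "e0 * norm x \<le> norm (ap (R - sc r) x)" if x: "x \<in> near_null K0 e0" for x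
  proof -
    have "x \<in> near_null K1 e1" using x near_null_mono[of K1 K0 e0 e1] by (auto simp: K0_def e0_def)
    from 1(4)[OF this] show ?thesis
      using mult_right_mono[of e0 e1 "norm x"] by (simp add: e0_def)
  qed
  have plus: "e0 * norm x \<le> norm (ap (R + sc r) x)" if x: "x \<in> near_null K0 e0" for x
  proof -
    have "x \<in> near_null K2 e2" using x near_null_mono[of K2 K0 e0 e2] by (auto simp: K0_def e0_def)
    from 2(4)[OF this] show ?thesis
      using mult_right_mono[of e0 e2 "norm x"] by (simp add: e0_def)
  qed
  have bdd: "bdd_below (bounds_near G R)"
    using bounds_near_nonneg[OF G] by (auto intro: bdd_belowI[of _ 0])
  have r0: "0 \<le> r"
    unfolding r_def using norm_in_bounds_near[of R G]
    by (intro cInf_greatest bounds_near_nonneg[OF G]) auto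
  have attained: "\<exists>x\<in>near_null K e. (r - d) * norm x < norm (ap R x)"
    if "K \<subseteq> G" "finite K" "0 < e" "0 < d" for K e d
  proof (rule ccontr)
    assume "\<not> ?thesis"
    then have "r - d \<in> bounds_near G R"
      using that by (auto simp: bounds_near_def not_less)
    then have "r \<le> r - d" unfolding r_def by (rule cInf_lower[OF _ bdd])
    then show False using that by simp
  qed
  have upper: "\<exists>K\<subseteq>G. finite K \<and> (\<exists>e>0. \<forall>x\<in>near_null K e. norm (ap R x) \<le> (r + d) * norm x)"
    if d: "0 < d" for d
  proof -
    obtain t where t: "t \<in> bounds_near G R" "t < r + d"
      using cInf_lessD[of "bounds_near G R" "r + d"] norm_in_bounds_near d
      by (auto simp: r_def)
    then obtain K e where K: "K \<subseteq> G" "finite K" "0 < e"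
      "\<forall>x\<in>near_null K e. norm (ap R x) \<le> t * norm x" by (auto simp: bounds_near_def)
    moreover have "t * norm x \<le> (r + d) * norm x" for x :: 'a using t by (intro mult_right_mono) auto
    ultimately show ?thesis by (meson order_trans)
  qed
  show False
  \<comment> \<open>The general argument needs \<open>r / 2\<close> as a positive lower growth
    factor of \<open>R\<close>. For \<open>r = 0\<close>, \<open>R\<close> itself is nearly 0 on
    nearly annihilated vectors.\<close>
  proof (cases "r = 0")
    case True
    obtain K e where K: "K \<subseteq> G" "finite K" "0 < e"
      "\<forall>x\<in>near_null K e. norm (ap R x) \<le> (r + e0 / 2) * norm x" using upper[of "e0 / 2"] e0 by auto
    have "near_null (K0 \<union> K) (min e0 e) \<noteq> {}"
      using G K K0 e0 by (simp add: approx_null_def)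
    then obtain x where x: "x \<in> near_null (K0 \<union> K) (min e0 e)" by blast
    then have "x \<in> near_null K0 e0" "x \<in> near_null K e"
      using near_null_mono[of K0 "K0 \<union> K" "min e0 e" e0] near_null_mono[of K "K0 \<union> K" "min e0 e" e]
      by auto
    then have "e0 * norm x \<le> e0 / 2 * norm x" "x \<noteq> 0"
      using minus[of x] K(4) True by (force simp: near_null_def)+
    then show False using e0 by simp
  next
    case False
    with r0 have r: "0 < r" by simp
    \<comment> \<open>This polynomial is the factor of \<open>(norm x)\<^sup>2\<close> in the upper
      bound below for the squared norm of \<open>R (R x) - r\<^sup>2 x\<close>, and it vanishes at
      \<open>d = 0\<close>. Requiring \<open>d < r / 2\<close> keeps \<open>r - d\<close> above
      \<open>r / 2\<close>.\<close>
    have "((\<lambda>d. (r + d) ^ 4 - 2 * r\<^sup>2 * (r - d)\<^sup>2 + r ^ 4) \<longlongrightarrow>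
        (r + 0) ^ 4 - 2 * r\<^sup>2 * (r - 0)\<^sup>2 + r ^ 4) (at_right 0)"
      by (intro tendsto_intros)
    moreover have "(r + 0) ^ 4 - 2 * r\<^sup>2 * (r - 0)\<^sup>2 + r ^ 4 < e0 ^ 4"
      using e0 by (simp add: power4_eq_xxxx power2_eq_square)
    ultimately have "\<forall>\<^sub>F d in at_right 0. (r + d) ^ 4 - 2 * r\<^sup>2 * (r - d)\<^sup>2 + r ^ 4 < e0 ^ 4"
      by (rule order_tendstoD)
    moreover have "\<forall>\<^sub>F d in at_right 0. 0 < d \<and> d < r / 2"
      using r by (auto simp: eventually_at_right_field intro!: exI[of _ "r / 2"])
    ultimately have "\<forall>\<^sub>F d in at_right 0. (r + d) ^ 4 - 2 * r\<^sup>2 * (r - d)\<^sup>2 + r ^ 4 < e0 ^ 4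
      \<and> 0 < d \<and> d < r / 2" by (rule eventually_conj)
    then obtain d where d: "(r + d) ^ 4 - 2 * r\<^sup>2 * (r - d)\<^sup>2 + r ^ 4 < e0 ^ 4" "0 < d" "d < r / 2"
      using eventually_happens trivial_limit_at_right_real by blast
    obtain K e where K: "K \<subseteq> G" "finite K" "0 < e"
      "\<And>x. x \<in> near_null K e \<Longrightarrow> norm (ap R x) \<le> (r + d) * norm x" using upper[OF d(2)] by blast
    \<comment> \<open>The last two entries allow \<open>near_null_ap\<close> to push
      \<open>x\<close> through \<open>R + sc r\<close> with lower factor \<open>e0\<close> and
      through \<open>R\<close> with lower factor \<open>r / 2\<close>; the added 1 keeps
      denominators positive.\<close>
    define h where "h = min (min e0 e) (min (e0\<^sup>2 / (norm (R + sc r) + 1)) (r / 2 * e / (norm R + 1)))"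
    have pos: "0 < norm T + 1" for T :: "'a bop" using norm_ge_zero[of T] by linarith
    then have h0: "0 < h"
      unfolding h_def using e0 K(3) r by (intro min_less_iff_conj[THEN iffD2] conjI divide_pos_pos pos mult_pos_pos) auto
    have hle: "norm T * h \<le> c" if "h \<le> c / (norm T + 1)" for T :: "'a bop" and c
    proof -
      have "h * (norm T + 1) \<le> c" using that pos by (simp add: pos_le_divide_eq)
      then show ?thesis using h0 by (simp add: algebra_simps)
    qed
    have h1: "norm (R + sc r) * h \<le> e0 * e0" and h2: "norm R * h \<le> r / 2 * e"
      using hle[of "e0\<^sup>2" "R + sc r"] hle[of "r / 2 * e" R] by (auto simp: h_def power2_eq_square)
    obtain x where x: "x \<in> near_null (K0 \<union> K) h" "(r - d) * norm x < norm (ap R x)"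
      using attained[of "K0 \<union> K" h d] K K0 h0 d by auto
    have x0: "x \<noteq> 0" using x by (simp add: near_null_def)
    have "h \<le> e0" "h \<le> e" by (auto simp: h_def)
    then have xK0: "x \<in> near_null K0 h" and xK: "x \<in> near_null K h" and xe: "x \<in> near_null K e"
      and xe0: "x \<in> near_null K0 e0"
      using x(1) near_null_mono[of K0 "K0 \<union> K" h h] near_null_mono[of K "K0 \<union> K" h h]
        near_null_mono[of K0 "K0 \<union> K" h e0] near_null_mono[of K "K0 \<union> K" h e]
      by blast+
    have "ap (R + sc r) x \<in> near_null K0 e0"
    proof (rule near_null_ap[OF xK0 _ e0 _ h1])
      show "B * (R + sc r) = (R + sc r) * B" if "B \<in> K0" for B
        using comm[of B] that K0 by (auto simp: distrib_left distrib_right sc_commute)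
    qed (use plus[OF xe0] e0 in auto)
    from minus[OF this] have "e0 * norm (ap (R + sc r) x) \<le> norm (ap (R - sc r) (ap (R + sc r) x))" .
    moreover have "ap (R - sc r) (ap (R + sc r) x) = ap R (ap R x) - (r\<^sup>2) *\<^sub>R x"
      by (simp add: ap_add ap_diff ap_scaleC scaleC_add_right scaleC_diff_right scaleR_scaleC scaleC_scaleC
          power2_eq_square)
    moreover have "e0 * (e0 * norm x) \<le> e0 * norm (ap (R + sc r) x)"
      using plus[OF xe0] e0 by (intro mult_left_mono) auto
    ultimately have lower: "e0\<^sup>2 * norm x \<le> norm (ap R (ap R x) - (r\<^sup>2) *\<^sub>R x)"
      by (simp add: power2_eq_square)
    have "(r / 2) * norm x \<le> (r - d) * norm x"
      using d by (intro mult_right_mono) auto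
    with x(2) have half: "(r / 2) * norm x \<le> norm (ap R x)" by simp
    have "ap R x \<in> near_null K e"
      by (rule near_null_ap[OF xK _ _ half h2]) (use comm K r in auto)
    then have "norm (ap R (ap R x)) \<le> (r + d) * norm (ap R x)" by (rule K(4))
    also have "\<dots> \<le> (r + d) * ((r + d) * norm x)"
      using K(4)[OF xe] r d by (intro mult_left_mono) auto
    finally have "(norm (ap R (ap R x)))\<^sup>2 \<le> ((r + d) * ((r + d) * norm x))\<^sup>2"
      by (rule power_mono) simp
    also have "\<dots> = (r + d) ^ 4 * (norm x)\<^sup>2" by (simp add: power_mult_distrib flip: power_mult)
    finally have RR: "(norm (ap R (ap R x)))\<^sup>2 \<le> (r + d) ^ 4 * (norm x)\<^sup>2" .
    have "((r - d) * norm x)\<^sup>2 \<le> (norm (ap R x))\<^sup>2"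
      using x(2) d r by (intro power_mono) auto
    then have Rx: "2 * r\<^sup>2 * ((r - d)\<^sup>2 * (norm x)\<^sup>2) \<le> 2 * r\<^sup>2 * (norm (ap R x))\<^sup>2"
      by (intro mult_left_mono) (auto simp: power_mult_distrib)
    \<comment> \<open>Selfadjointness turns the cross term into
      \<open>(norm (ap R x))\<^sup>2\<close>, which is large by the choice of
      \<open>x\<close>.\<close>
    have "cinner (ap R (ap R x)) ((r\<^sup>2) *\<^sub>R x) = complex_of_real (r\<^sup>2 * (norm (ap R x))\<^sup>2)"
      unfolding cinner_ap[of R "ap R x"]
      by (simp add: sa scaleR_scaleC ap_scaleC cinner_scaleC_right cinner_self)
    then have "(norm (ap R (ap R x) - (r\<^sup>2) *\<^sub>R x))\<^sup>2
        = (norm (ap R (ap R x)))\<^sup>2 + r ^ 4 * (norm x)\<^sup>2 - 2 * r\<^sup>2 * (norm (ap R x))\<^sup>2"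
      by (simp add: norm_diff_sq power_mult_distrib flip: power_mult)
    also have "\<dots> \<le> ((r + d) ^ 4 - 2 * r\<^sup>2 * (r - d)\<^sup>2 + r ^ 4) * (norm x)\<^sup>2"
      using RR Rx by (simp add: algebra_simps)
    also have "\<dots> < e0 ^ 4 * (norm x)\<^sup>2"
      using d x0 by (intro mult_strict_right_mono) auto
    also have "\<dots> = (e0\<^sup>2 * norm x)\<^sup>2" by (simp add: power_mult_distrib flip: power_mult)
    also have "\<dots> \<le> (norm (ap R (ap R x) - (r\<^sup>2) *\<^sub>R x))\<^sup>2"
      using lower e0 by (intro power_mono) auto
    finally show False by simp
  qed
qed

lemma Inf_bounds_near_empty: "Inf (bounds_near {} T) = norm T" if "approx_null ({} :: 'a bop set)"
  for T :: "'a::complex_hilbert bop"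
proof (rule cInf_eq_minimum)
  show "norm T \<in> bounds_near {} T" by (rule norm_in_bounds_near)
  fix t assume t: "t \<in> bounds_near {} T"
  show "norm T \<le> t"
  proof (rule norm_bop_bound)
    show "0 \<le> t" by (rule bounds_near_nonneg[OF that t])
    show "norm (ap T x) \<le> t * norm x" for x
      using t by (cases "x = 0") (auto simp: bounds_near_def near_null_def)
  qed
qed

text \<open>Unlike in \<^const>\<open>characters\<close>, the zero functional is included.\<close>

definition chr :: "'a::complex_hilbert bop set \<Rightarrow> ('a bop \<Rightarrow> complex) \<Rightarrow> bool"
  where "chr A w \<longleftrightarrow> (\<forall>S\<in>A. \<forall>T\<in>A. w (S + T) = w S + w T \<and> w (S * T) = w S * w T) \<and>
    (\<forall>c. \<forall>T\<in>A. w (sc c * T) = c * w T)"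

text \<open>For the empty set the growth factor in \<open>approx_null_extend\<close> is the operator
  norm, so the maximal set can be started from \<open>T - sc l0\<close> with \<open>l0\<close> equal
  to plus or minus \<open>norm T\<close>; this fixes the value at \<open>T\<close>. Maximality makes
  the set a proper ideal, and extending it once more yields a scalar for every selfadjoint
  element.\<close>

lemma selfadjoint_character_attains_norm:
  fixes C :: "'a::complex_hilbert bop set"
  assumes C_sc: "\<And>c. sc c \<in> C" and C_add: "\<And>S T. S \<in> C \<Longrightarrow> T \<in> C \<Longrightarrow> S + T \<in> C"
    and C_mult: "\<And>S T. S \<in> C \<Longrightarrow> T \<in> C \<Longrightarrow> S * T \<in> C"
    and C_star: "\<And>T. T \<in> C \<Longrightarrow> star T \<in> C"
    and C_comm: "\<And>S T. S \<in> C \<Longrightarrow> T \<in> C \<Longrightarrow> S * T = T * S"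
    and T: "T \<in> C" "star T = T" "T \<noteq> 0"
  shows "\<exists>w. chr C w \<and> cmod (w T) = norm T"
proof -
  have C_diff: "S - T \<in> C" if "S \<in> C" "T \<in> C" for S T
  proof -
    have "S - T = S + sc (-1) * T" by (rule bop_eqI) (simp add: scaleC_minus1)
    then show ?thesis using that C_sc C_add C_mult by metis
  qed
  obtain x where "ap T x \<noteq> 0" using T(3) by (metis bop_eqI ap_simps(1))
  then have "x \<noteq> 0" by auto
  then have null: "approx_null ({} :: 'a bop set)"
    by (auto simp: approx_null_def near_null_def)
  obtain l0 where l0: "cmod l0 = norm T" "approx_null {T - sc l0}"
  proof -
    have "approx_null {T - sc (norm T)} \<or> approx_null {T + sc (norm T)}"
      using approx_null_extend[OF null, of T] T(2) by (simp add: Inf_bounds_near_empty[OF null])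
    moreover have "T + sc (norm T) = T - sc (- of_real (norm T))"
      by (simp add: sc_minus)
    ultimately show ?thesis
      using that[of "of_real (norm T)"] that[of "- of_real (norm T)"] by auto
  qed
  define GG where "GG = {G. G \<subseteq> C \<and> approx_null G \<and> T - sc l0 \<in> G}"
  have "\<exists>M\<in>GG. \<forall>X\<in>GG. M \<subseteq> X \<longrightarrow> X = M"
  proof (rule subset_Zorn_nonempty)
    show "GG \<noteq> {}" using l0 T C_diff C_sc by (auto simp: GG_def)
    fix CC assume ne: "CC \<noteq> {}" and chain: "subset.chain GG CC"
    have "approx_null (\<Union>CC)"
      unfolding approx_null_def
    proof (intro allI impI)
      fix K :: "'a bop set" and e :: real
      assume K: "K \<subseteq> \<Union>CC" "finite K" and e: "0 < e"
      obtain X where "X \<in> CC" "K \<subseteq> X"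
        by (rule finite_subset_Union_chain[OF K(2,1) ne chain])
      then show "near_null K e \<noteq> {}"
        using chain K e by (auto simp: GG_def approx_null_def subset.chain_def)
    qed
    then show "\<Union>CC \<in> GG"
      using chain ne by (auto simp: GG_def subset.chain_def)
  qed
  then obtain G where GG: "G \<in> GG" and G_max: "\<forall>X\<in>GG. G \<subseteq> X \<longrightarrow> X = G"
    by (elim bexE)
  from GG have G: "G \<subseteq> C" "approx_null G" "T - sc l0 \<in> G"
    by (auto simp: GG_def)
  have max: "X = G" if "X \<subseteq> C" "approx_null X" "G \<subseteq> X" for X
    using G_max that G(3) by (auto simp: GG_def)
  \<comment> \<open>\<open>B\<close> is small wherever \<open>B1\<close> and \<open>B2\<close> are,
    so adjoining it preserves \<open>approx_null\<close> and maximality puts it into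
    \<open>G\<close>. Both ideal properties are instances.\<close>
  have dominated: "B \<in> G" if B: "B \<in> C" "B1 \<in> G" "B2 \<in> G"
    and c: "\<And>x. norm (ap B x) \<le> c * (norm (ap B1 x) + norm (ap B2 x))" for B B1 B2 c
  proof -
    have "approx_null (insert B G)"
      unfolding approx_null_def
    proof (intro allI impI)
      fix K :: "'a bop set" and e :: real
      assume K: "K \<subseteq> insert B G" "finite K" and e: "0 < e"
      define e' where "e' = min e (e / (2 * (\<bar>c\<bar> + 1)))"
      have e': "0 < e'" using e by (simp add: e'_def)
      have "e' \<le> e / (2 * (\<bar>c\<bar> + 1))" by (simp add: e'_def)
      then have ce: "\<bar>c\<bar> * (2 * e') \<le> e"
        using e' by (simp add: pos_le_divide_eq algebra_simps)
      have "near_null (insert B1 (insert B2 (K - {B}))) e' \<noteq> {}"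
        by (rule G(2)[unfolded approx_null_def, rule_format, OF _ _ e']) (use K B in auto)
      then obtain x where x: "x \<in> near_null (insert B1 (insert B2 (K - {B}))) e'" by blast
      have "norm (ap B x) \<le> \<bar>c\<bar> * (norm (ap B1 x) + norm (ap B2 x))"
        using c[of x] by (rule order_trans) (intro mult_right_mono, auto)
      also have "\<dots> \<le> \<bar>c\<bar> * (e' * norm x + e' * norm x)"
        using x by (intro mult_left_mono add_mono) (auto simp: near_null_def)
      also have "\<dots> = \<bar>c\<bar> * (2 * e') * norm x" by simp
      also have "\<dots> \<le> e * norm x" using ce by (rule mult_right_mono) simp
      finally have "norm (ap B x) \<le> e * norm x" .
      moreover have "e' * norm x \<le> e * norm x" by (intro mult_right_mono) (auto simp: e'_def)
      ultimately have "x \<in> near_null K e"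
        using x unfolding near_null_def mem_Collect_eq
        by (metis Diff_iff insertCI order_trans singletonD)
      then show "near_null K e \<noteq> {}" by blast
    qed
    then have "insert B G = G" using G B by (intro max) auto
    then show ?thesis by blast
  qed
  have G_add: "B1 + B2 \<in> G" if "B1 \<in> G" "B2 \<in> G" for B1 B2
    by (rule dominated[of _ B1 B2 1]) (use that G(1) C_add in \<open>auto intro: norm_triangle_ineq\<close>)
  have G_mult: "R * B \<in> G" if "B \<in> G" "R \<in> C" for B R
  proof (rule dominated[of _ B B "norm R"])
    have "norm R * norm (ap B x) \<le> norm R * (norm (ap B x) + norm (ap B x))" for x
      by (rule mult_left_mono) auto
    then show "norm (ap (R * B) x) \<le> norm R * (norm (ap B x) + norm (ap B x))" for x
      unfolding ap_simps(6) by (rule order_trans[OF norm_ap])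
  qed (use that G(1) C_mult in auto)
  have G_1: "1 \<notin> G"
  proof
    assume "1 \<in> G"
    then have "near_null {1 :: 'a bop} (1/2) \<noteq> {}" using G(2) by (simp add: approx_null_def)
    then show False by (auto simp: near_null_def)
  qed
  have real_eigenvalue: "\<exists>l. R - sc l \<in> G" if R: "R \<in> C" "star R = R" for R
  proof -
    define r where "r = Inf (bounds_near G R)"
    have "approx_null (insert (R - sc r) G) \<or> approx_null (insert (R + sc r) G)"
      unfolding r_def using R G C_comm by (intro approx_null_extend) auto
    then have "insert (R - sc r) G = G \<or> insert (R + sc r) G = G"
      using max R G(1) C_diff C_add C_sc by (metis insert_subset subset_insertI)
    moreover have "R + sc r = R - sc (- of_real r)"
      by (simp add: sc_minus)
    ultimately show ?thesis by (metis insertI1)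
  qed
  have eigenvalue: "\<exists>l. R - sc l \<in> G" if R: "R \<in> C" for R
  proof -
    define H1 where "H1 = sc (1/2) * (R + star R)"
    define H2 where "H2 = sc (1/(2 * \<i>)) * (R - star R)"
    have "star H1 = H1" "star H2 = H2"
      by (auto simp: H1_def H2_def star_mult star_add star_diff sc_commute intro!: bop_eqI
          simp: scaleC_diff_right scaleC_minus_left add.commute)
    moreover have "H1 \<in> C" "H2 \<in> C"
      using R C_star C_mult C_add C_diff C_sc by (auto simp: H1_def H2_def)
    ultimately obtain l1 l2 where l: "H1 - sc l1 \<in> G" "H2 - sc l2 \<in> G"
      using real_eigenvalue by metis
    have "R = H1 + sc \<i> * H2"
      by (rule bop_eqI) (simp add: H1_def H2_def scaleC_scaleC scaleC_diff_right scaleC_add_right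
          flip: scaleC_add_left)
    then have "R - sc (l1 + \<i> * l2) = (H1 - sc l1) + sc \<i> * (H2 - sc l2)"
      by (simp add: sc_add sc_mult algebra_simps)
    then show ?thesis using l G_add G_mult C_sc by metis
  qed
  have unique: "l = m" if "R - sc l \<in> G" "R - sc m \<in> G" for R l m
  proof (rule ccontr)
    assume "l \<noteq> m"
    then have "1 = sc (1 / (m - l)) * sc (m - l)" by (simp flip: sc_mult)
    also have "\<dots> = sc (1 / (m - l)) * ((R - sc l) + sc (-1) * (R - sc m))"
      by (rule arg_cong[where f = "\<lambda>X. _ * X"]) (rule bop_eqI, simp add: scaleC_minus1 scaleC_diff_left)
    finally show False using that G_add G_mult C_sc G_1 by metis
  qed
  define w where "w R = (THE l. R - sc l \<in> G)" for R
  have w: "w R = l" if "R - sc l \<in> G" for R l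
    unfolding w_def using that unique by blast
  have wG: "R - sc (w R) \<in> G" if "R \<in> C" for R
    using eigenvalue[OF that] w by metis
  have "chr C w"
    unfolding chr_def
  proof (intro conjI ballI allI)
    fix R S assume RS: "R \<in> C" "S \<in> C"
    have "(R + S) - sc (w R + w S) = (R - sc (w R)) + (S - sc (w S))"
      by (simp add: sc_add)
    then show "w (R + S) = w R + w S" using RS wG G_add w by metis
    have "R * S - sc (w R * w S) = R * (S - sc (w S)) + sc (w S) * (R - sc (w R))"
      by (simp add: sc_mult algebra_simps sc_commute[of R]) (simp add: mult.commute flip: sc_mult)
    then show "w (R * S) = w R * w S" using RS wG G_add G_mult C_sc w by metis
  next
    fix c R assume R: "R \<in> C"
    have "sc c * R - sc (c * w R) = sc c * (R - sc (w R))"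
      by (simp add: sc_mult algebra_simps)
    then show "w (sc c * R) = c * w R" using R wG G_mult C_sc w by metis
  qed
  moreover have "cmod (w T) = norm T" using w[OF G(3)] l0 by simp
  ultimately show ?thesis by blast
qed

section \<open>Commutative C*-algebras: boundedness, reality and separation by characters\<close>

locale comm_cstar =
  fixes A :: "'a::complex_hilbert bop set"
  assumes closed: "closed A" and zero: "0 \<in> A"
    and add: "\<And>S T. S \<in> A \<Longrightarrow> T \<in> A \<Longrightarrow> S + T \<in> A"
    and mult: "\<And>S T. S \<in> A \<Longrightarrow> T \<in> A \<Longrightarrow> S * T \<in> A"
    and scale: "\<And>c T. T \<in> A \<Longrightarrow> sc c * T \<in> A"
    and star: "\<And>T. T \<in> A \<Longrightarrow> star T \<in> A"
    and comm: "\<And>S T. S \<in> A \<Longrightarrow> T \<in> A \<Longrightarrow> S * T = T * S"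
begin

lemma minus: "T \<in> A \<Longrightarrow> - T \<in> A"
  using scale[of T "-1"] by (simp add: sc_minus)

lemma diff: "S \<in> A \<Longrightarrow> T \<in> A \<Longrightarrow> S - T \<in> A"
  using add[of S "- T"] minus[of T] by simp

lemma chr_add: "chr A w \<Longrightarrow> S \<in> A \<Longrightarrow> T \<in> A \<Longrightarrow> w (S + T) = w S + w T"
  and chr_mult: "chr A w \<Longrightarrow> S \<in> A \<Longrightarrow> T \<in> A \<Longrightarrow> w (S * T) = w S * w T"
  and chr_scale: "chr A w \<Longrightarrow> T \<in> A \<Longrightarrow> w (sc c * T) = c * w T"
  by (auto simp: chr_def)

lemma chr_zero: "chr A w \<Longrightarrow> w 0 = 0"
  using chr_scale[OF _ zero, of w 0] by simp

lemma chr_diff: "w (S - T) = w S - w T" if "chr A w" "S \<in> A" "T \<in> A"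
  using chr_add[OF that(1) diff[OF that(2,3)] that(3)] by simp

text \<open>If \<open>w U = 1\<close> and \<open>norm U < 1\<close>, then \<open>V = U + U V\<close> for the Neumann series \<open>V\<close> of \<open>U\<close>,
  which gives \<open>w V = 1 + w V\<close>.\<close>

lemma chr_bound:
  assumes w: "chr A w" and T: "T \<in> A"
  shows "cmod (w T) \<le> norm T"
proof (rule ccontr)
  assume "\<not> ?thesis"
  then have less: "norm T < cmod (w T)" by simp
  then have wT: "w T \<noteq> 0" using norm_ge_zero[of T] by auto
  define U where "U = sc (1 / w T) * T"
  have U: "U \<in> A" using T by (simp add: U_def scale)
  have wU: "w U = 1" using wT by (simp add: U_def chr_scale[OF w T])
  have nU: "norm U < 1" using less wT by (simp add: U_def norm_sc_mult norm_divide divide_simps)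
  \<comment> \<open>The series starts with \<open>U\<close> itself, since 1 need not lie in
    \<open>A\<close>.\<close>
  define f where "f n = U ^ Suc n" for n
  have fA: "f n \<in> A" for n by (induction n) (auto simp: f_def U intro: mult)
  have "summable (\<lambda>n. norm U ^ n)" using nU by (simp add: summable_geometric)
  then have sf: "summable f"
  proof (rule summable_comparison_test'[where N = 0])
    fix n
    have "norm (f n) \<le> norm U ^ Suc n" unfolding f_def by (rule norm_power_bop_le) simp
    also have "\<dots> \<le> norm U ^ n" using nU by (intro power_decreasing) auto
    finally show "norm (f n) \<le> norm U ^ n" .
  qed
  define V where "V = suminf f"
  have V: "V \<in> A"
  proof (rule closed_sequentially[OF closed])
    show "(\<lambda>n. sum f {..<n}) \<longlonglongrightarrow> V" unfolding V_def by (rule summable_LIMSEQ[OF sf])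
    show "sum f {..<n} \<in> A" for n by (induction n) (auto simp: zero add fA)
  qed
  have "U * V = (\<Sum>n. U * f n)" unfolding V_def by (rule suminf_mult[OF sf, symmetric])
  also have "\<dots> = (\<Sum>n. f (Suc n))" by (simp add: f_def)
  also have "\<dots> = V - U" unfolding V_def using suminf_split_head[OF sf] by (simp add: f_def)
  finally have "w (U * V) = w V - w U" using chr_diff[OF w V U] by simp
  then show False using chr_mult[OF w U V] wU by simp
qed

text \<open>The unitization is avoided: \<open>w\<close> is evaluated at \<open>(T + sc c)^n U\<close> with \<open>w U = 1\<close>.\<close>

lemma chr_bound_unit:
  assumes w: "chr A w" and T: "T \<in> A" and U: "U \<in> A" "w U = 1"
  shows "cmod (w T + c) \<le> norm (T + sc c)"
proof (rule ccontr)
  define X where "X = T + sc c"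
  define z where "z = w T + c"
  assume "\<not> ?thesis"
  then have less: "norm X < cmod z" by (simp add: X_def z_def)
  then have z0: "0 < cmod z" using norm_ge_zero[of X] by linarith
  have XU: "X ^ n * U \<in> A \<and> w (X ^ n * U) = z ^ n" for n
  proof (induction n)
    case (Suc n)
    have "X ^ Suc n * U = T * (X ^ n * U) + sc c * (X ^ n * U)"
      by (simp add: X_def distrib_right mult.assoc)
    then show ?case
      using Suc T by (simp add: add mult scale chr_add[OF w] chr_mult[OF w] chr_scale[OF w] z_def
          distrib_right)
  qed (use U in simp)
  have "1 \<le> (norm X / cmod z) ^ n * norm U" for n
  proof -
    have "cmod z ^ n \<le> norm (X ^ n * U)" using chr_bound[OF w] XU[of n] by (metis norm_power)
    also have "\<dots> \<le> norm X ^ n * norm U"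
      by (intro order_trans[OF norm_mult_ineq] mult_right_mono norm_power_bop_le) auto
    finally show ?thesis using z0 by (simp add: power_divide field_simps)
  qed
  moreover have "(\<lambda>n. (norm X / cmod z) ^ n * norm U) \<longlonglongrightarrow> 0 * norm U"
    using less z0 by (intro tendsto_mult tendsto_const LIMSEQ_realpow_zero) auto
  ultimately have "1 \<le> 0 * norm U" by (intro LIMSEQ_le_const) auto
  then show False by simp
qed

text \<open>Arens' trick: adding an imaginary scalar i t to \<open>T\<close> raises the squared norm
  bound by \<open>t\<^sup>2\<close> only, whereas \<open>cmod (w T + c)\<close> squared contains the
  cross term \<open>2 * (b * t)\<close>.\<close>

lemma chr_selfadjoint_real:
  assumes w: "chr A w" and T: "T \<in> A" "star T = T"
  shows "Im (w T) = 0"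
proof (rule ccontr)
  define b where "b = Im (w T)"
  assume "Im (w T) \<noteq> 0"
  then have b: "b \<noteq> 0" by (simp add: b_def)
  then have "w T \<noteq> 0" by (auto simp: b_def)
  then have U: "sc (1 / w T) * T \<in> A" "w (sc (1 / w T) * T) = 1"
    using T by (auto simp: scale chr_scale[OF w])
  \<comment> \<open>Chosen so that the cross term is \<open>2 * (norm T)\<^sup>2 + 2\<close> and
    exceeds the allowance \<open>(norm T)\<^sup>2\<close>.\<close>
  define t where "t = ((norm T)\<^sup>2 + 1) / b"
  define c where "c = \<i> * complex_of_real t"
  have "star (T + sc c) * (T + sc c) = T * T + sc (of_real (t\<^sup>2))"
  proof -
    have "cnj c = - c" "c * c = - of_real (t\<^sup>2)"
      by (simp_all add: c_def power2_eq_square algebra_simps)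
    then show ?thesis
      by (intro bop_eqI) (simp add: T star_add ap_add ap_scaleC scaleC_minus_left scaleC_add_right
          scaleC_diff_right scaleC_scaleC del: of_real_power)
  qed
  then have "(norm (T + sc c))\<^sup>2 \<le> norm (T * T) + norm (sc (of_real (t\<^sup>2)) :: 'a bop)"
    by (metis norm_star_mult_self norm_triangle_ineq)
  also have "\<dots> \<le> (norm T)\<^sup>2 + t\<^sup>2"
    using norm_mult_ineq[of T T] norm_sc_le[of "of_real (t\<^sup>2)", where 'a = 'a]
    by (intro add_mono) (auto simp: power2_eq_square norm_mult)
  finally have "(norm (T + sc c))\<^sup>2 \<le> (norm T)\<^sup>2 + t\<^sup>2" .
  moreover have "(cmod (w T + c))\<^sup>2 \<le> (norm (T + sc c))\<^sup>2"
    by (intro power_mono chr_bound_unit[OF w T(1) U]) simp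
  moreover have "(cmod (w T + c))\<^sup>2 = (Re (w T))\<^sup>2 + b\<^sup>2 + t\<^sup>2 + 2 * (b * t)"
    by (simp add: cmod_power2 c_def b_def power2_sum)
  moreover have "b * t = (norm T)\<^sup>2 + 1" using b by (simp add: t_def)
  ultimately have "(Re (w T))\<^sup>2 + b\<^sup>2 + (norm T)\<^sup>2 + 2 \<le> 0" by simp
  then show False
    using zero_le_power2[of "Re (w T)"] zero_le_power2[of b] zero_le_power2[of "norm T"] by linarith
qed

text \<open>Scalars are adjoined inside B(H), and the character found on the larger algebra is
  restricted to \<open>A\<close>.\<close>

lemma selfadjoint_chr_attains_norm:
  assumes T: "T \<in> A" "star T = T"
  shows "\<exists>w. chr A w \<and> cmod (w T) = norm T"
proof (cases "T = 0")
  case True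
  then show ?thesis by (intro exI[of _ "\<lambda>_. 0"]) (simp add: chr_def)
next
  case False
  define C where "C = {S + sc c |S c. S \<in> A}"
  have CI: "S + sc c \<in> C" if "S \<in> A" for S c using that by (auto simp: C_def)
  have AC: "S \<in> C" if "S \<in> A" for S using CI[OF that, of 0] by simp
  have "\<exists>w. chr C w \<and> cmod (w T) = norm T"
  proof (rule selfadjoint_character_attains_norm)
    show "sc c \<in> C" for c using CI[OF zero] by simp
    fix X Y assume "X \<in> C" "Y \<in> C"
    then obtain R S c d where X: "X = R + sc c" "R \<in> A" and Y: "Y = S + sc d" "S \<in> A"
      by (auto simp: C_def)
    have "X + Y = (R + S) + sc (c + d)" by (simp add: X Y sc_add)
    then show "X + Y \<in> C" using CI add X Y by metis
    have "X * Y = (R * S + (sc d * R + sc c * S)) + sc (c * d)"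
      by (simp add: X Y distrib_left distrib_right sc_mult sc_commute[of R])
    then show "X * Y \<in> C" using CI add mult scale X Y by metis
    have "star X = star R + sc (cnj c)" by (simp add: X star_add)
    then show "star X \<in> C" using CI star X by metis
    show "X * Y = Y * X"
      by (simp add: X Y distrib_left distrib_right sc_commute[of R] sc_commute[of S]
          sc_commute[of "sc c" d] comm[OF X(2) Y(2)])
  qed (use T False AC in auto)
  then obtain w where "chr C w" "cmod (w T) = norm T" by blast
  then show ?thesis using AC by (intro exI[of _ w]) (auto simp: chr_def)
qed

lemma chr_separating:
  assumes T: "T \<in> A" and 0: "\<And>w. chr A w \<Longrightarrow> w T = 0"
  shows "T = 0"
proof -
  have sT: "star T \<in> A" using T by (rule star)
  obtain w where w: "chr A w" "cmod (w (star T * T)) = norm (star T * T)"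
    using selfadjoint_chr_attains_norm[OF mult[OF sT T]] by (auto simp: star_mult)
  then have "norm (star T * T) = 0" using chr_mult[OF w(1) sT T] 0[OF w(1)] by simp
  then show ?thesis by (simp only: norm_star_mult_self) simp
qed

text \<open>The indicator of \<open>{w. w h \<noteq> 0}\<close> is the uniform limit of \<open>1 - (1 - h\<^sup>2 / M) ^ n\<close>.\<close>

lemma indicator_of_support:
  assumes h: "h \<in> A" "star h = h" and c: "0 < c"
    and gap: "\<And>w. chr A w \<Longrightarrow> w h = 0 \<or> c \<le> cmod (w h)"
  shows "\<exists>P\<in>A. \<forall>w. chr A w \<longrightarrow> w P = (if w h = 0 then 0 else 1)"
proof -
  \<comment> \<open>Keeps the values of \<open>k\<close> at characters in [0, 1]; the added 1 covers
    \<open>h = 0\<close>.\<close>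
  define M where "M = (norm h)\<^sup>2 + 1"
  define k where "k = sc (of_real (1 / M)) * (h * h)"
  \<comment> \<open>\<open>max 0\<close> covers \<open>c\<^sup>2 > M\<close>, which is possible when
    every character vanishes at \<open>h\<close>.\<close>
  define d where "d = max 0 (1 - c\<^sup>2 / M)"
  have M: "0 < M" by (simp add: M_def add_nonneg_pos)
  have d: "0 \<le> d" "d < 1" using c M by (auto simp: d_def)
  have k: "k \<in> A" using h by (simp add: k_def scale mult)
  have sk: "star k = k" by (simp add: k_def star_mult h sc_commute)
  define x where "x w = (Re (w h))\<^sup>2 / M" for w :: "'a bop \<Rightarrow> complex"
  have wk: "w k = of_real (x w)" and x0: "0 \<le> x w" "x w \<le> 1"
    and xd: "w h \<noteq> 0 \<Longrightarrow> 1 - x w \<le> d" and xz: "w h = 0 \<Longrightarrow> x w = 0" if w: "chr A w" for w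
  proof -
    have re: "w h = of_real (Re (w h))"
      using chr_selfadjoint_real[OF w h] by (simp add: complex_eq_iff)
    then have abs: "cmod (w h) = \<bar>Re (w h)\<bar>" by (metis norm_of_real)
    have "w k = of_real (1 / M) * (w h * w h)"
      using h by (simp add: k_def chr_scale[OF w] chr_mult[OF w] mult)
    then show "w k = of_real (x w)"
      by (subst (asm) (1 2) re) (simp add: x_def power2_eq_square)
    show "0 \<le> x w" using M by (simp add: x_def)
    have "(cmod (w h))\<^sup>2 \<le> (norm h)\<^sup>2" by (intro power_mono chr_bound w h) simp
    then show "x w \<le> 1" using M by (simp add: x_def abs M_def divide_le_eq)
    show "x w = 0" if "w h = 0" using that by (simp add: x_def)
    assume "w h \<noteq> 0"
    then have "c\<^sup>2 \<le> (cmod (w h))\<^sup>2" using gap[OF w] c by (intro power_mono) auto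
    then have "c\<^sup>2 / M \<le> x w" unfolding x_def using M by (intro divide_right_mono) (auto simp: abs)
    then show "1 - x w \<le> d" by (simp add: d_def)
  qed
  \<comment> \<open>Formally \<open>1 - q (Suc n) = (1 - k) * (1 - q n)\<close>, written so that no
    unit appears and \<open>q n\<close> stays in \<open>A\<close>.\<close>
  define q where "q = rec_nat 0 (\<lambda>_ Q. k + Q - k * Q)"
  have q0: "q 0 = 0" and qSuc: "q (Suc n) = k + q n - k * q n" for n by (auto simp: q_def)
  have qA: "q n \<in> A" and sq: "star (q n) = q n" for n
  proof -
    show qA: "q n \<in> A" for n
      by (induction n) (auto simp: q0 qSuc zero k add mult diff)
    show "star (q n) = q n"
      by (induction n) (auto simp: q0 qSuc star_add star_diff star_mult sk comm[OF k qA])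
  qed
  have wq: "w (q n) = 1 - of_real (1 - x w) ^ n" if w: "chr A w" for w n
  proof (induction n)
    case (Suc n)
    have "w (q (Suc n)) = w k + w (q n) - w k * w (q n)"
      using k qA by (simp add: qSuc chr_add[OF w] chr_diff[OF w] chr_mult[OF w] add mult)
    then show ?case by (simp add: Suc wk[OF w] algebra_simps)
  qed (simp add: q0 chr_zero w)
  have dq: "norm (q (Suc n) - q n) \<le> d ^ n" for n
  proof -
    \<comment> \<open>The norm is read off at one character: \<open>(1 - x) ^ n * x\<close> is 0
      where \<open>w h = 0\<close>, and elsewhere the gap makes it geometrically small.\<close>
    obtain w where w: "chr A w" "cmod (w (q (Suc n) - q n)) = norm (q (Suc n) - q n)"
      using selfadjoint_chr_attains_norm[of "q (Suc n) - q n"] qA sq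
      by (auto simp: diff star_diff)
    have "w (q (Suc n) - q n) = of_real ((1 - x w) ^ n * x w)"
      using qA by (simp add: chr_diff[OF w(1)] wq[OF w(1)] algebra_simps)
    then have *: "norm (q (Suc n) - q n) = (1 - x w) ^ n * x w"
      using w(2) x0[OF w(1)] by (simp only: norm_of_real) simp
    show ?thesis
    proof (cases "w h = 0")
      case True
      then show ?thesis using d xz[OF w(1)] by (simp add: *)
    next
      case False
      have "(1 - x w) ^ n * x w \<le> d ^ n * 1"
        using xd[OF w(1) False] x0[OF w(1)] by (intro mult_mono power_mono) (auto simp: d)
      then show ?thesis by (simp add: *)
    qed
  qed
  have "summable (\<lambda>n. d ^ n)" using d by (simp add: summable_geometric)
  then have "summable (\<lambda>n. q (Suc n) - q n)"
    by (rule summable_comparison_test'[where N = 0]) (rule dq)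
  then have "convergent q"
    by (simp add: summable_iff_convergent sum_lessThan_telescope q0)
  then obtain P where P: "q \<longlonglongrightarrow> P" by (auto simp: convergent_def)
  have PA: "P \<in> A" by (rule closed_sequentially[OF closed qA P])
  have "w P = (if w h = 0 then 0 else 1)" if w: "chr A w" for w
  proof (rule LIMSEQ_unique)
    show "(\<lambda>n. w (q n)) \<longlonglongrightarrow> w P"
    proof (rule Lim_null_comparison[THEN LIM_zero_cancel])
      show "\<forall>\<^sub>F n in sequentially. norm (w (q n) - w P) \<le> norm (q n - P)"
        using chr_bound[OF w diff[OF qA PA]] by (simp add: chr_diff[OF w qA PA])
      show "(\<lambda>n. norm (q n - P)) \<longlonglongrightarrow> 0"
        using tendsto_norm[OF LIM_zero[OF P]] by simp
    qed
    show "(\<lambda>n. w (q n)) \<longlonglongrightarrow> (if w h = 0 then 0 else 1)"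
    proof (cases "w h = 0")
      case False
      have "(\<lambda>n. 1 - complex_of_real (1 - x w) ^ n) \<longlonglongrightarrow> 1 - 0"
        using xd[OF w False] x0[OF w] d
        by (intro tendsto_diff tendsto_const LIMSEQ_power_zero) (simp add: norm_of_real del: of_real_diff)
      then show ?thesis using False by (simp add: wq[OF w])
    qed (simp add: wq[OF w] xz[OF w])
  qed
  then show ?thesis using PA by blast
qed

end

section \<open>The Gelfand representation\<close>

lemma bl_of_simps:
  "bl_of S + bl_of T = bl_of (S + T)" "bl_of S o\<^sub>L bl_of T = bl_of (S * T)"
  "op_scaleC c (bl_of T) = bl_of (sc c * T)" "adj (bl_of T) = bl_of (star T)" "0 = bl_of 0"
  "id_blinfun = bl_of 1"
  by (auto simp: plus_bop.rep_eq times_bop.rep_eq star.rep_eq zero_bop.rep_eq one_bop.rep_eq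
      sc.rep_eq intro!: blinfun_eqI)

lemma continuous_map_complex_mult:
  fixes f g :: "'b \<Rightarrow> complex"
  assumes "continuous_map X euclidean f" "continuous_map X euclidean g"
  shows "continuous_map X euclidean (\<lambda>x. f x * g x)"
  using assms by (simp add: continuous_map_atin tendsto_mult)

lemma closedin_Collect_ball:
  assumes "\<And>i. i \<in> I \<Longrightarrow> closedin X {x \<in> topspace X. P i x}"
  shows "closedin X {x \<in> topspace X. \<forall>i\<in>I. P i x}"
proof (cases "I = {}")
  case False
  then have "{x \<in> topspace X. \<forall>i\<in>I. P i x} = (\<Inter>i\<in>I. {x \<in> topspace X. P i x})" by auto
  then show ?thesis using assms False by auto
qed simp

text \<open>\<open>B\<close> is the algebra in the ring type; \<open>A\<close> is its copy among
  bounded real-linear maps, to which \<open>characters\<close> and \<open>gelfand\<close>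
  refer.\<close>

locale operator_cstar = comm_cstar B for B :: "'a::complex_hilbert bop set" +
  fixes A :: "('a \<Rightarrow>\<^sub>L 'a) set"
  assumes A_def: "A = bl_of ` B"
begin

lemma Bop_bl_of [simp]: "Bop (bl_of T) = T"
  by (rule bl_of_inverse)

lemma chr_of_character: "\<omega> \<in> characters A \<Longrightarrow> chr B (\<lambda>T. \<omega> (bl_of T))"
  by (auto simp: characters_def chr_def A_def bl_of_simps)

lemma character_of_chr:
  assumes w: "chr B w" and T: "T \<in> B" "w T \<noteq> 0"
  obtains \<omega> where "\<omega> \<in> characters A" "\<And>T. T \<in> B \<Longrightarrow> \<omega> (bl_of T) = w T"
proof
  let ?w = "restrict (w \<circ> Bop) A"
  show *: "?w (bl_of T) = w T" if "T \<in> B" for T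
    using that by (simp add: A_def)
  show "?w \<in> characters A"
    unfolding characters_def
  proof (intro CollectI conjI ballI allI)
    show "?w \<in> extensional A" by simp
    show "\<exists>T\<in>A. ?w T \<noteq> 0"
      using T *[OF T(1)] by (intro bexI[of _ "bl_of T"]) (auto simp: A_def)
  next
    fix S T assume "S \<in> A" "T \<in> A"
    then obtain S' T' where ST: "S = bl_of S'" "S' \<in> B" "T = bl_of T'" "T' \<in> B"
      by (auto simp: A_def)
    then show "?w (S + T) = ?w S + ?w T" "?w (S o\<^sub>L T) = ?w S * ?w T"
      by (simp_all only: bl_of_simps * add mult chr_add[OF w] chr_mult[OF w])
  next
    fix c T assume "T \<in> A"
    then obtain T' where T: "T = bl_of T'" "T' \<in> B" by (auto simp: A_def)
    then show "?w (op_scaleC c T) = c * ?w T"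
      by (simp only: bl_of_simps * scale chr_scale[OF w])
  qed
qed

lemma gelfand_apply: "\<omega> \<in> characters A \<Longrightarrow> gelfand A T \<omega> = \<omega> T"
  by (simp add: gelfand_def)

lemma gelfand_inj: "inj_on (gelfand A) A"
proof (rule inj_onI)
  fix S T assume "S \<in> A" "T \<in> A" and eq: "gelfand A S = gelfand A T"
  then obtain S' T' where ST: "S = bl_of S'" "S' \<in> B" "T = bl_of T'" "T' \<in> B"
    by (auto simp: A_def)
  have "S' - T' = 0"
  proof (rule chr_separating[OF diff])
    fix w assume w: "chr B w"
    show "w (S' - T') = 0"
    proof (rule ccontr)
      assume "w (S' - T') \<noteq> 0"
      then obtain \<omega> where \<omega>: "\<omega> \<in> characters A" "\<And>T. T \<in> B \<Longrightarrow> \<omega> (bl_of T) = w T"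
        using character_of_chr[OF w diff[OF ST(2,4)]] by blast
      then have "w S' = w T'" using eq ST gelfand_apply by metis
      then show False using \<open>w (S' - T') \<noteq> 0\<close> chr_diff[OF w ST(2,4)] by simp
    qed
  qed (use ST in auto)
  then show "S = T" using ST by simp
qed

lemma continuous_map_gelfand:
  assumes "T \<in> A"
  shows "continuous_map (char_space A) euclidean (gelfand A T)"
proof (rule continuous_map_eq)
  show "continuous_map (char_space A) euclidean (\<lambda>\<omega>. \<omega> T)"
    unfolding char_space_def
    by (intro continuous_map_from_subtopology continuous_map_product_projection assms)
qed (simp add: topspace_char_space gelfand_def)

text \<open>Tychonoff: the set in question is closed in a product of discs of radius
  \<open>norm T\<close>. Being nonzero is not a closed condition on functionals, but
  \<open>e \<le> cmod (\<omega> P)\<close> is, and it implies it.\<close>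

lemma gelfand_C0:
  assumes P: "P \<in> A"
  shows "gelfand A P \<in> C0 (char_space A)"
proof -
  have "compactin (char_space A) {\<omega> \<in> characters A. e \<le> cmod (\<omega> P)}" if e: "0 < e" for e
  proof -
    let ?X = "product_topology (\<lambda>_. euclidean :: complex topology) A"
    let ?D = "PiE A (\<lambda>T. cball 0 (norm T))"
    have proj: "continuous_map ?X euclidean (\<lambda>\<omega>. \<omega> T)" if "T \<in> A" for T
      using continuous_map_product_projection[OF that, of "\<lambda>_. euclidean"] .
    have "A \<noteq> {}" using P by blast
    have closed_A: "S + T \<in> A" "S o\<^sub>L T \<in> A" "op_scaleC c T \<in> A" if "S \<in> A" "T \<in> A" for S T c
      using that by (auto simp: A_def bl_of_simps add mult scale)
    define Z1 where "Z1 = {\<omega> \<in> topspace ?X. \<forall>S\<in>A. \<forall>T\<in>A. \<omega> (S + T) = \<omega> S + \<omega> T}"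
    define Z2 where "Z2 = {\<omega> \<in> topspace ?X. \<forall>S\<in>A. \<forall>T\<in>A. \<omega> (S o\<^sub>L T) = \<omega> S * \<omega> T}"
    define Z3 where "Z3 = {\<omega> \<in> topspace ?X. \<forall>c\<in>UNIV. \<forall>T\<in>A. \<omega> (op_scaleC c T) = c * \<omega> T}"
    define Z4 where "Z4 = {\<omega> \<in> topspace ?X. cmod (\<omega> P) \<in> {e..}}"
    have "closedin ?X Z1"
      unfolding Z1_def
      by (intro closedin_Collect_ball closedin_continuous_maps_eq[OF Hausdorff_space_euclidean]
          continuous_map_add proj closed_A)
    moreover have "closedin ?X Z2"
      unfolding Z2_def
      by (intro closedin_Collect_ball closedin_continuous_maps_eq[OF Hausdorff_space_euclidean]
          continuous_map_complex_mult proj closed_A)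
    moreover have "closedin ?X Z3"
      unfolding Z3_def
      by (intro closedin_Collect_ball closedin_continuous_maps_eq[OF Hausdorff_space_euclidean]
          continuous_map_complex_mult proj closed_A(3)) simp_all
    moreover have "closedin ?X Z4"
      unfolding Z4_def
      by (rule closedin_continuous_map_preimage[OF continuous_map_norm[OF proj[OF P]]]) simp
    ultimately have "closedin ?X (Z1 \<inter> Z2 \<inter> Z3 \<inter> Z4)" by (intro closedin_Int)
    moreover have K: "{\<omega> \<in> characters A. e \<le> cmod (\<omega> P)} = Z1 \<inter> Z2 \<inter> Z3 \<inter> Z4"
      using P e
      by (auto simp: Z1_def Z2_def Z3_def Z4_def characters_def PiE_def intro!: bexI[of _ P])
    moreover have "{\<omega> \<in> characters A. e \<le> cmod (\<omega> P)} \<subseteq> ?D"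
    proof
      fix \<omega> assume "\<omega> \<in> {\<omega> \<in> characters A. e \<le> cmod (\<omega> P)}"
      then have \<omega>: "\<omega> \<in> characters A" by simp
      have "cmod (\<omega> T) \<le> norm T" if "T \<in> A" for T
        using that chr_bound[OF chr_of_character[OF \<omega>]] by (auto simp: A_def norm_bop.rep_eq)
      then show "\<omega> \<in> ?D" using \<omega> by (auto simp: characters_def PiE_def)
    qed
    moreover have "compactin ?X ?D" by (simp add: compactin_PiE)
    ultimately have "compactin ?X {\<omega> \<in> characters A. e \<le> cmod (\<omega> P)}"
      using closed_compactin by metis
    then show ?thesis by (auto simp: char_space_def compactin_subtopology)
  qed
  moreover have "{\<omega> \<in> characters A. e \<le> cmod (gelfand A P \<omega>)} = {\<omega> \<in> characters A. e \<le> cmod (\<omega> P)}" for e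
    by (auto simp: gelfand_def)
  ultimately show ?thesis
    using continuous_map_gelfand[OF P] by (simp add: C0_def topspace_char_space gelfand_def)
qed

text \<open>Membership in C0 makes \<open>S\<close> compact, as the set where the indicator has
  modulus at least 1. A continuous function vanishing exactly off \<open>S\<close> then has a
  positive minimum modulus on \<open>S\<close>, which is the gap that
  \<open>indicator_of_support\<close> asks for.\<close>

lemma char_fun_in_range_gelfand:
  assumes C0: "char_fun (characters A) S \<in> C0 (char_space A)" and N: "N \<in> A"
    and supp: "supp_on (characters A) (gelfand A N) = S"
      "supp_on (characters A) (gelfand A (adj N)) = S"
  shows "char_fun (characters A) S \<in> gelfand A ` A"
proof -
  obtain N' where N': "N = bl_of N'" "N' \<in> B" using N by (auto simp: A_def)
  \<comment> \<open>Selfadjoint, and by multiplicativity of characters its transform is nonzero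
    exactly on the common support \<open>S\<close> of \<open>N\<close> and
    \<open>adj N\<close>.\<close>
  define h where "h = star N' * N'"
  have h: "h \<in> B" "star h = h" using N' by (auto simp: h_def star_mult mult star)
  have hA: "bl_of h \<in> A" using h by (simp add: A_def)
  have \<omega>h: "\<omega> (bl_of h) = \<omega> (adj N) * \<omega> N" if "\<omega> \<in> characters A" for \<omega>
    using chr_mult[OF chr_of_character[OF that] star[OF N'(2)] N'(2)]
    by (simp add: h_def N' bl_of_simps)
  have S: "S = {\<omega> \<in> characters A. \<omega> (bl_of h) \<noteq> 0}"
  proof -
    have "supp_on (characters A) (gelfand A T) = {\<omega> \<in> characters A. \<omega> T \<noteq> 0}" for T
      by (auto simp: supp_on_def gelfand_def)
    with supp have "\<omega> \<in> S \<longleftrightarrow> \<omega> \<in> characters A \<and> \<omega> N \<noteq> 0"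
      "\<omega> \<in> S \<longleftrightarrow> \<omega> \<in> characters A \<and> \<omega> (adj N) \<noteq> 0" for \<omega>
      by auto
    then have "\<omega> \<in> S \<longleftrightarrow> \<omega> \<in> characters A \<and> \<omega> (bl_of h) \<noteq> 0" for \<omega>
      using \<omega>h by (metis mult_eq_0_iff)
    then show ?thesis by blast
  qed
  have "compactin (char_space A) {\<omega> \<in> characters A. 1 \<le> cmod (char_fun (characters A) S \<omega>)}"
    using C0 zero_less_one by (simp add: C0_def topspace_char_space del: zero_less_one)
  moreover have "{\<omega> \<in> characters A. 1 \<le> cmod (char_fun (characters A) S \<omega>)} = S"
    using S by (auto simp: char_fun_def split: if_splits)
  ultimately have "compactin (char_space A) S" by simp
  from image_compactin[OF this continuous_map_norm[OF continuous_map_gelfand[OF hA]]]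
  have cpt: "compact ((\<lambda>\<omega>. cmod (gelfand A (bl_of h) \<omega>)) ` S)" by simp
  obtain c where c: "0 < c" "\<And>\<omega>. \<omega> \<in> S \<Longrightarrow> c \<le> cmod (\<omega> (bl_of h))"
  proof (cases "S = {}")
    case True
    then show ?thesis using that[of 1] by simp
  next
    case False
    then obtain \<omega>0 where "\<omega>0 \<in> S"
      "\<And>\<omega>. \<omega> \<in> S \<Longrightarrow> cmod (gelfand A (bl_of h) \<omega>0) \<le> cmod (gelfand A (bl_of h) \<omega>)"
      using compact_attains_inf[OF cpt] by auto
    then show ?thesis using that[of "cmod (\<omega>0 (bl_of h))"] S by (auto simp: gelfand_def)
  qed
  have "w h = 0 \<or> c \<le> cmod (w h)" if w: "chr B w" for w
  proof (rule disjCI)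
    assume "\<not> c \<le> cmod (w h)"
    show "w h = 0"
    proof (rule ccontr)
      assume "w h \<noteq> 0"
      then obtain \<omega> where "\<omega> \<in> characters A" "\<And>T. T \<in> B \<Longrightarrow> \<omega> (bl_of T) = w T"
        using character_of_chr[OF w h(1)] by blast
      then show False using c(2)[of \<omega>] S \<open>w h \<noteq> 0\<close> h(1) \<open>\<not> c \<le> cmod (w h)\<close> by simp
    qed
  qed
  then have "\<exists>P\<in>B. \<forall>w. chr B w \<longrightarrow> w P = (if w h = 0 then 0 else 1)"
    by (rule indicator_of_support[OF h c(1)])
  then obtain P where P: "P \<in> B" "\<And>w. chr B w \<Longrightarrow> w P = (if w h = 0 then 0 else 1)"
    by blast
  have "gelfand A (bl_of P) = char_fun (characters A) S"
    unfolding gelfand_def char_fun_def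
  proof (rule restrict_ext)
    fix \<omega> assume \<omega>: "\<omega> \<in> characters A"
    then show "\<omega> (bl_of P) = (if \<omega> \<in> S then 1 else 0)"
      using P(2)[OF chr_of_character[OF \<omega>]] S by simp
  qed
  then show ?thesis using P(1) by (auto simp: A_def intro!: image_eqI[of _ _ "bl_of P"])
qed

end

section \<open>The generated algebra and the generated semigroup\<close>

lemma ex_bl_of: "\<exists>T'. T = bl_of T'" if "T \<in> bounded_ops"
  using that by (rule bl_of_cases) blast

text \<open>Guarantees that the hull is an intersection over a nonempty family, so it stays inside
  \<open>bounded_ops\<close>.\<close>

lemma cstar_subalgebra_bounded_ops: "cstar_subalgebra bounded_ops"
  unfolding cstar_subalgebra_def
  by (auto simp: closed_bounded_ops adj_bounded_ops elim!: bl_of_cases)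
    (simp_all add: bl_of_simps bl_of del: plus_bop.rep_eq)

lemma cstar_subalgebra_generated:
  assumes "F \<subseteq> bounded_ops"
  shows "cstar_subalgebra (cstar_generated F)"
proof -
  have hull: "cstar_generated F = \<Inter>{A. cstar_subalgebra A \<and> F \<subseteq> A}"
    by (auto simp: cstar_generated_def hull_def)
  have "cstar_generated F \<subseteq> bounded_ops"
    using assms cstar_subalgebra_bounded_ops by (auto simp: hull)
  moreover have "closed (cstar_generated F)"
    unfolding hull by (rule closed_Inter) (auto simp: cstar_subalgebra_def)
  ultimately show ?thesis
    unfolding cstar_subalgebra_def by (auto simp: hull) (auto simp: cstar_subalgebra_def)
qed

text \<open>Invariance of \<open>X\<close> under adjoints gives closure under \<open>adj\<close>:
  take adjoints in \<open>T o\<^sub>L adj S = adj S o\<^sub>L T\<close>.\<close>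

lemma cstar_subalgebra_commutant:
  fixes X :: "('a::complex_hilbert \<Rightarrow>\<^sub>L 'a) set"
  assumes X: "X \<subseteq> bounded_ops" and adj_X: "\<And>S. S \<in> X \<Longrightarrow> adj S \<in> X"
  shows "cstar_subalgebra {T \<in> bounded_ops. \<forall>S\<in>X. T o\<^sub>L S = S o\<^sub>L T}"
proof -
  have "bounded_linear (\<lambda>T. T o\<^sub>L S)" "bounded_linear (\<lambda>T. S o\<^sub>L T)" for S :: "'a \<Rightarrow>\<^sub>L 'a"
    by (rule bounded_bilinear.bounded_linear_left[OF bounded_bilinear_blinfun_compose],
        rule bounded_bilinear.bounded_linear_right[OF bounded_bilinear_blinfun_compose])
  then have "closed {T. T o\<^sub>L S = S o\<^sub>L T}" for S :: "'a \<Rightarrow>\<^sub>L 'a"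
    by (intro closed_Collect_eq linear_continuous_on) auto
  then have "closed (bounded_ops \<inter> (\<Inter>S\<in>X. {T. T o\<^sub>L S = S o\<^sub>L T}))"
    by (intro closed_Int closed_bounded_ops closed_INT) auto
  also have "bounded_ops \<inter> (\<Inter>S\<in>X. {T. T o\<^sub>L S = S o\<^sub>L T})
      = {T \<in> bounded_ops. \<forall>S\<in>X. T o\<^sub>L S = S o\<^sub>L T}"
    by auto
  finally have closed: "closed {T \<in> bounded_ops. \<forall>S\<in>X. T o\<^sub>L S = S o\<^sub>L T}" .
  note alg = cstar_subalgebra_bounded_ops[unfolded cstar_subalgebra_def]
  have "(S + T) o\<^sub>L R = R o\<^sub>L (S + T)" "(S o\<^sub>L T) o\<^sub>L R = R o\<^sub>L (S o\<^sub>L T)"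
    if RST: "R \<in> bounded_ops" "S \<in> bounded_ops" "T \<in> bounded_ops"
      and c: "S o\<^sub>L R = R o\<^sub>L S" "T o\<^sub>L R = R o\<^sub>L T" for R S T :: "'a \<Rightarrow>\<^sub>L 'a"
  proof -
    obtain R' S' T' where e: "R = bl_of R'" "S = bl_of S'" "T = bl_of T'"
      using RST[THEN ex_bl_of] by blast
    with c have c: "S' * R' = R' * S'" "T' * R' = R' * T'"
      by (simp_all add: bl_of_simps bl_of_inject)
    have "S' * (T' * R') = R' * (S' * T')" by (metis c mult.assoc)
    then show "(S + T) o\<^sub>L R = R o\<^sub>L (S + T)" "(S o\<^sub>L T) o\<^sub>L R = R o\<^sub>L (S o\<^sub>L T)"
      using c by (simp_all add: e bl_of_simps distrib_left distrib_right mult.assoc)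
  qed
  moreover have "op_scaleC c T o\<^sub>L R = R o\<^sub>L op_scaleC c T"
    if "R \<in> bounded_ops" "T o\<^sub>L R = R o\<^sub>L T" for R T :: "'a \<Rightarrow>\<^sub>L 'a" and c
    using that by (auto intro!: blinfun_eqI simp: bounded_ops_scaleC
        dest: arg_cong[where f = blinfun_apply] fun_cong) (metis blinfun_apply_blinfun_compose)
  moreover have "adj T o\<^sub>L R = R o\<^sub>L adj T"
    if R: "R \<in> X" and T: "T \<in> bounded_ops" "\<forall>S\<in>X. T o\<^sub>L S = S o\<^sub>L T" for R T :: "'a \<Rightarrow>\<^sub>L 'a"
  proof -
    obtain R' T' where e: "R = bl_of R'" "T = bl_of T'"
      using ex_bl_of T(1) subsetD[OF X R] by blast
    have "T o\<^sub>L adj R = adj R o\<^sub>L T" using T adj_X[OF R] by blast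
    then have "T' * star R' = star R' * T'" by (simp add: e bl_of_simps bl_of_inject)
    then have "star (T' * star R') = star (star R' * T')" by simp
    then show ?thesis by (simp add: e bl_of_simps star_mult)
  qed
  ultimately show ?thesis
    unfolding cstar_subalgebra_def using closed alg X by (auto dest: subsetD)
qed

text \<open>Minimality is used twice: the algebra lies in the commutant of the generators, so the
  generators lie in the commutant of the algebra, and hence so does the algebra.\<close>

lemma cstar_generated_commute:
  assumes F: "F \<subseteq> bounded_ops"
    and comm: "\<And>S T. S \<in> F \<union> adj ` F \<Longrightarrow> T \<in> F \<union> adj ` F \<Longrightarrow> S o\<^sub>L T = T o\<^sub>L S"
    and ST: "S \<in> cstar_generated F" "T \<in> cstar_generated F"
  shows "S o\<^sub>L T = T o\<^sub>L S"
proof -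
  have alg: "cstar_subalgebra (cstar_generated F)" by (rule cstar_subalgebra_generated[OF F])
  have FA: "F \<subseteq> cstar_generated F" unfolding cstar_generated_def by (rule hull_subset)
  have adj_adj: "adj (adj N) = N" if "N \<in> F" for N
    using that F by (auto elim!: bl_of_cases simp: bl_of_simps dest!: subsetD)
  have X: "F \<union> adj ` F \<subseteq> bounded_ops" using F adj_bounded_ops by auto
  have 1: "cstar_generated F \<subseteq> {T \<in> bounded_ops. \<forall>S\<in>F \<union> adj ` F. T o\<^sub>L S = S o\<^sub>L T}"
    unfolding cstar_generated_def
  proof (rule hull_minimal)
    show "F \<subseteq> {T \<in> bounded_ops. \<forall>S\<in>F \<union> adj ` F. T o\<^sub>L S = S o\<^sub>L T}"
      using F comm by blast
    show "cstar_subalgebra {T \<in> bounded_ops. \<forall>S\<in>F \<union> adj ` F. T o\<^sub>L S = S o\<^sub>L T}"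
      by (rule cstar_subalgebra_commutant[OF X]) (auto simp: adj_adj)
  qed
  have "cstar_subalgebra hull F
      \<subseteq> {T \<in> bounded_ops. \<forall>S\<in>cstar_generated F. T o\<^sub>L S = S o\<^sub>L T}"
  proof (rule hull_minimal)
    show "F \<subseteq> {T \<in> bounded_ops. \<forall>S\<in>cstar_generated F. T o\<^sub>L S = S o\<^sub>L T}"
      using F 1 by fastforce
    show "cstar_subalgebra {T \<in> bounded_ops. \<forall>S\<in>cstar_generated F. T o\<^sub>L S = S o\<^sub>L T}"
      using alg by (intro cstar_subalgebra_commutant) (auto simp: cstar_subalgebra_def)
  qed
  then show ?thesis using ST unfolding cstar_generated_def by blast
qed

lemma fuglede_blinfun:
  assumes "normal_op M" "N \<in> bounded_ops" "M o\<^sub>L N = N o\<^sub>L M"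
  shows "adj M o\<^sub>L N = N o\<^sub>L adj M"
proof -
  obtain M' N' where e: "M = bl_of M'" "N = bl_of N'"
    using ex_bl_of[of M] ex_bl_of[OF assms(2)] assms(1) unfolding normal_op_def by blast
  show ?thesis
    using assms fuglede[of M' N'] by (simp add: e normal_op_def bl_of_simps bl_of_inject)
qed

lemma adj_compose: "adj (S o\<^sub>L T) = adj T o\<^sub>L adj S" if ST: "S \<in> bounded_ops" "T \<in> bounded_ops"
proof -
  obtain S' T' where "S = bl_of S'" "T = bl_of T'" using ST[THEN ex_bl_of] by blast
  then show ?thesis by (simp add: bl_of_simps star_mult)
qed

text \<open>Fuglede handles the mixed pairs; pairs of adjoints come from taking adjoints of the
  given relation.\<close>

lemma commuting_normal_family_with_adjoints:
  assumes normal: "\<And>N. N \<in> F \<Longrightarrow> normal_op N"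
    and comm: "\<And>M N. M \<in> F \<Longrightarrow> N \<in> F \<Longrightarrow> M o\<^sub>L N = N o\<^sub>L M"
    and ST: "S \<in> F \<union> adj ` F" "T \<in> F \<union> adj ` F"
  shows "S o\<^sub>L T = T o\<^sub>L S"
proof -
  have bdd: "N \<in> bounded_ops" if "N \<in> F" for N using normal[OF that] by (simp add: normal_op_def)
  have 1: "adj M o\<^sub>L N = N o\<^sub>L adj M" if "M \<in> F" "N \<in> F" for M N
    using fuglede_blinfun normal bdd comm that by metis
  have 2: "adj M o\<^sub>L adj N = adj N o\<^sub>L adj M" if "M \<in> F" "N \<in> F" for M N
    using adj_compose bdd comm that by metis
  show ?thesis using ST comm 1 2 by auto
qed

section \<open>Words and simplicity of the generated semigroup\<close>

lemma op_prod_Nil [simp]: "op_prod [] = id_blinfun"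
  and op_prod_Cons [simp]: "op_prod (N # Ns) = N o\<^sub>L op_prod Ns"
  by (simp_all add: op_prod_def)

lemma blinfun_compose_assoc: "(R o\<^sub>L S) o\<^sub>L T = R o\<^sub>L (S o\<^sub>L T)"
  by (rule blinfun_eqI) simp

lemma id_compose [simp]: "id_blinfun o\<^sub>L T = T" "T o\<^sub>L id_blinfun = T"
  by (rule blinfun_eqI, simp)+

lemma op_prod_append: "op_prod (Ms @ Ns) = op_prod Ms o\<^sub>L op_prod Ns"
  by (induction Ms) (simp_all add: blinfun_compose_assoc)

lemma sa_semigroup_compose:
  "S \<in> sa_semigroup F \<Longrightarrow> T \<in> sa_semigroup F \<Longrightarrow> S o\<^sub>L T \<in> sa_semigroup F"
proof -
  fix S T assume "S \<in> sa_semigroup F" "T \<in> sa_semigroup F"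
  then obtain Ms Ns where "S = op_prod Ms" "Ms \<noteq> []" "set Ms \<subseteq> F \<union> adj ` F"
    "T = op_prod Ns" "set Ns \<subseteq> F \<union> adj ` F"
    by (auto simp: sa_semigroup_def)
  then show "S o\<^sub>L T \<in> sa_semigroup F"
    unfolding sa_semigroup_def by (intro CollectI exI[of _ "Ms @ Ns"]) (simp add: op_prod_append)
qed

lemma sa_semigroup_generator: "N \<in> F \<union> adj ` F \<Longrightarrow> N \<in> sa_semigroup F"
  unfolding sa_semigroup_def by (auto intro!: exI[of _ "[N]"])

text \<open>The identity need not lie in \<open>A\<close>, so the induction bottoms out at
  one-letter words.\<close>

lemma sa_semigroup_subset:
  assumes A: "\<And>S T. S \<in> A \<Longrightarrow> T \<in> A \<Longrightarrow> S o\<^sub>L T \<in> A" and F: "F \<union> adj ` F \<subseteq> A"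
  shows "sa_semigroup F \<subseteq> A"
proof -
  have "op_prod As \<in> A" if "As \<noteq> []" "set As \<subseteq> F \<union> adj ` F" for As
    using that
  proof (induction As)
    case (Cons N Ns)
    then show ?case using A F by (cases "Ns = []") auto
  qed simp
  then show ?thesis by (auto simp: sa_semigroup_def)
qed

text \<open>In an abelian semigroup \<open>A o\<^sub>L S\<close> is an ideal, so simplicity means that \<open>S\<close> is a group.\<close>

lemma simple_abelian_semigroup_division:
  assumes simple: "simple_semigroup S"
    and mult: "\<And>A B. A \<in> S \<Longrightarrow> B \<in> S \<Longrightarrow> A o\<^sub>L B \<in> S"
    and comm: "\<And>A B. A \<in> S \<Longrightarrow> B \<in> S \<Longrightarrow> A o\<^sub>L B = B o\<^sub>L A"
    and A: "A \<in> S" and B: "B \<in> S"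
  shows "\<exists>X\<in>S. A o\<^sub>L X = B"
proof -
  have "semigroup_ideal S ((o\<^sub>L) A ` S)"
    unfolding semigroup_ideal_def
  proof (intro conjI ballI)
    show "(o\<^sub>L) A ` S \<noteq> {}" "(o\<^sub>L) A ` S \<subseteq> S" using A mult by auto
    fix Y X assume "Y \<in> (o\<^sub>L) A ` S" and X: "X \<in> S"
    then obtain Z where Z: "Z \<in> S" "Y = A o\<^sub>L Z" by blast
    have "Y o\<^sub>L X = A o\<^sub>L (Z o\<^sub>L X)" by (simp add: Z blinfun_compose_assoc)
    moreover have "X o\<^sub>L Y = Y o\<^sub>L X" using comm[OF X] mult[OF A Z(1)] Z(2) by simp
    ultimately show "X o\<^sub>L Y \<in> (o\<^sub>L) A ` S" "Y o\<^sub>L X \<in> (o\<^sub>L) A ` S"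
      using mult[OF Z(1) X] by auto
  qed
  then have "(o\<^sub>L) A ` S = S" using simple by (simp add: simple_semigroup_def)
  then have "B \<in> (o\<^sub>L) A ` S" using B by simp
  then show ?thesis by blast
qed

text \<open>Nonempty distinct lists stand for nonempty finite subsets; the order is immaterial by
  commutativity. \<open>inv_into\<close> is the inverse of \<phi>, because \<open>gelfand\<close> is
  injective on the algebra and the indicator lies in its range wherever the value is used.\<close>

theorem corollary2p4:
  fixes F :: "('a::complex_hilbert \<Rightarrow>\<^sub>L 'a) set"
  assumes "\<And>N. N \<in> F \<Longrightarrow> normal_op N \<and> N \<noteq> 0"
    and "\<And>M N. M \<in> F \<Longrightarrow> N \<in> F \<Longrightarrow> M o\<^sub>L N = N o\<^sub>L M"
  shows "simple_semigroup (sa_semigroup F) \<longleftrightarrow>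
    (let A = cstar_generated F; \<Omega> = characters A; \<phi> = gelfand A in
      \<exists>S\<subseteq>\<Omega>. (\<forall>N\<in>F \<union> adj ` F. supp_on \<Omega> (\<phi> N) = S) \<and>
        char_fun \<Omega> S \<in> C0 (char_space A) \<and>
        (let P = inv_into A \<phi> (char_fun \<Omega> S) in
          \<forall>Ns. Ns \<noteq> [] \<and> distinct Ns \<and> set Ns \<subseteq> F \<union> adj ` F \<longrightarrow>
            (\<exists>W\<in>sa_semigroup F \<union> {id_blinfun}. P = op_prod Ns o\<^sub>L W)))"
proof -
  define A where A_eq: "A = cstar_generated F"
  define \<Omega> where "\<Omega> = characters A"
  define Sg where "Sg = sa_semigroup F"
  have F: "F \<subseteq> bounded_ops" using assms(1) by (auto simp: normal_op_def)
  have gen_comm: "S o\<^sub>L T = T o\<^sub>L S" if "S \<in> F \<union> adj ` F" "T \<in> F \<union> adj ` F" for S T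
    using commuting_normal_family_with_adjoints[OF _ assms(2) that] assms(1) by blast
  have alg: "cstar_subalgebra A" unfolding A_eq by (rule cstar_subalgebra_generated[OF F])
  note A = alg[unfolded cstar_subalgebra_def]
  have A_comm: "S o\<^sub>L T = T o\<^sub>L S" if "S \<in> A" "T \<in> A" for S T
    using that cstar_generated_commute[OF F gen_comm] by (simp add: A_eq)
  have FA: "F \<union> adj ` F \<subseteq> A"
    using A hull_subset[of F cstar_subalgebra] by (auto simp: A_eq cstar_generated_def)
  have SgA: "Sg \<subseteq> A"
    unfolding Sg_def by (rule sa_semigroup_subset[OF _ FA]) (use A in blast)
  have Sg_mult: "S o\<^sub>L T \<in> Sg" if "S \<in> Sg" "T \<in> Sg" for S T
    using that sa_semigroup_compose by (simp add: Sg_def)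
  have Sg_comm: "S o\<^sub>L T = T o\<^sub>L S" if "S \<in> Sg" "T \<in> Sg" for S T
    using that SgA A_comm by blast
  have Sg_gen: "N \<in> Sg" if "N \<in> F \<union> adj ` F" for N
    using that sa_semigroup_generator by (simp add: Sg_def)
  define B where "B = {T. bl_of T \<in> A}"
  have AB: "A = bl_of ` B"
  proof
    show "A \<subseteq> bl_of ` B"
    proof
      fix T assume T: "T \<in> A"
      then obtain T' where "T = bl_of T'" using A ex_bl_of by blast
      then show "T \<in> bl_of ` B" using T by (simp add: B_def)
    qed
  qed (auto simp: B_def)
  interpret operator_cstar B A
  proof
    have "closed (bl_of -` A)"
      using A continuous_on_bl_of by (intro closed_vimage) auto
    then show "closed B" by (simp add: B_def vimage_def)
    show "S * T = T * S" if "S \<in> B" "T \<in> B" for S T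
      using A_comm[of "bl_of S" "bl_of T"] that by (simp add: B_def bl_of_simps bl_of_inject)
    show "sc c * T \<in> B" if "T \<in> B" for c T
    proof -
      have "bl_of (sc c * T) = op_scaleC c (bl_of T)" by (simp only: bl_of_simps)
      then show ?thesis using that A by (simp add: B_def)
    qed
    show "A = bl_of ` B" by (rule AB)
  qed (use A in \<open>simp_all add: B_def flip: bl_of_simps\<close>)
  have \<phi>: "gelfand A T \<omega> = \<omega> T" if "\<omega> \<in> \<Omega>" for T \<omega>
    using that by (simp add: gelfand_def \<Omega>_def)
  have \<omega>_mult: "\<omega> (S o\<^sub>L T) = \<omega> S * \<omega> T" if "\<omega> \<in> \<Omega>" "S \<in> A" "T \<in> A" for \<omega> S T
    using that by (simp add: \<Omega>_def characters_def)
  have "simple_semigroup Sg \<longleftrightarrow>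
      (\<exists>S\<subseteq>\<Omega>. (\<forall>N\<in>F \<union> adj ` F. supp_on \<Omega> (gelfand A N) = S) \<and>
        char_fun \<Omega> S \<in> C0 (char_space A) \<and>
        (\<forall>Ns. Ns \<noteq> [] \<and> distinct Ns \<and> set Ns \<subseteq> F \<union> adj ` F \<longrightarrow>
            (\<exists>W\<in>Sg \<union> {id_blinfun}. inv_into A (gelfand A) (char_fun \<Omega> S) = op_prod Ns o\<^sub>L W)))"
    (is "_ \<longleftrightarrow> (\<exists>S\<subseteq>\<Omega>. ?supp S \<and> ?C0 S \<and> ?words S)")
  proof
    assume simple: "simple_semigroup Sg"
    have division: "\<exists>X\<in>Sg. R o\<^sub>L X = T" if "R \<in> Sg" "T \<in> Sg" for R T
      by (rule simple_abelian_semigroup_division[OF simple _ _ that]) (fact Sg_mult Sg_comm)+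
    show "\<exists>S\<subseteq>\<Omega>. ?supp S \<and> ?C0 S \<and> ?words S"
    proof (cases "F = {}")
      case True
      \<comment> \<open>The semigroup is empty here and provides no unit; the indicator of the empty
        set is the transform of 0.\<close>
      have "char_fun \<Omega> {} = gelfand A 0"
        unfolding char_fun_def gelfand_def \<Omega>_def
      proof (rule restrict_ext)
        fix \<omega> assume "\<omega> \<in> characters A"
        then have "\<omega> (0 + 0) = \<omega> 0 + \<omega> 0" using A by (simp only: characters_def mem_Collect_eq)
        then show "(if \<omega> \<in> {} then 1 else 0) = \<omega> 0" by simp
      qed
      then have "?C0 {}" using gelfand_C0[of 0] A by simp
      then show ?thesis using True by (intro exI[of _ "{}"]) auto
    next
      case False
      then obtain N0 where "N0 \<in> Sg" using Sg_gen by blast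
      \<comment> \<open>A unit for \<open>N0\<close> is one for every \<open>T = N0 X\<close>. In
        particular \<open>P\<close> is idempotent, so characters take only the values 0 and 1 on
        it.\<close>
      from division[OF this this] obtain P where P: "P \<in> Sg" "N0 o\<^sub>L P = N0" by blast
      have unit: "T o\<^sub>L P = T" if T: "T \<in> Sg" for T
      proof -
        obtain X where "X \<in> Sg" "N0 o\<^sub>L X = T" using division[OF \<open>N0 \<in> Sg\<close> T] by blast
        then have "T o\<^sub>L P = X o\<^sub>L (N0 o\<^sub>L P)"
          using Sg_comm[OF \<open>N0 \<in> Sg\<close>] by (metis blinfun_compose_assoc)
        then show ?thesis using P \<open>N0 o\<^sub>L X = T\<close> Sg_comm[OF \<open>N0 \<in> Sg\<close> \<open>X \<in> Sg\<close>] by simp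
      qed
      have PA: "P \<in> A" using P SgA by blast
      define S where "S = {\<omega> \<in> \<Omega>. \<omega> P \<noteq> 0}"
      have \<omega>P: "\<omega> P = (if \<omega> \<in> S then 1 else 0)" if "\<omega> \<in> \<Omega>" for \<omega>
        using \<omega>_mult[OF that PA PA] unit[OF P(1)] that by (auto simp: S_def)
      have \<phi>P: "gelfand A P = char_fun \<Omega> S"
        unfolding gelfand_def char_fun_def \<Omega>_def[symmetric] by (rule restrict_ext) (rule \<omega>P)
      have inv: "inv_into A (gelfand A) (char_fun \<Omega> S) = P"
        unfolding \<phi>P[symmetric] by (rule inv_into_f_f[OF gelfand_inj PA])
      have "supp_on \<Omega> (gelfand A N) = S" if N: "N \<in> F \<union> adj ` F" for N
      proof -
        obtain X where X: "X \<in> Sg" "N o\<^sub>L X = P" using division[OF Sg_gen[OF N] P(1)] by blast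
        have "N \<in> A" "X \<in> A" using N FA X SgA by auto
        \<comment> \<open>\<open>N P = N\<close> gives one direction, \<open>N X = P\<close> the
          other.\<close>
        then have "\<omega> N = 0 \<longleftrightarrow> \<omega> P = 0" if "\<omega> \<in> \<Omega>" for \<omega>
          using \<omega>_mult[OF that \<open>N \<in> A\<close> PA] \<omega>_mult[OF that \<open>N \<in> A\<close> \<open>X \<in> A\<close>] X unit[OF Sg_gen[OF N]]
          by auto
        then show ?thesis by (auto simp: supp_on_def \<phi> S_def)
      qed
      moreover have "?C0 S" using gelfand_C0[OF PA] by (simp add: \<phi>P)
      moreover have "?words S"
      proof (intro allI impI)
        fix Ns assume "Ns \<noteq> [] \<and> distinct Ns \<and> set Ns \<subseteq> F \<union> adj ` F"
        then have "op_prod Ns \<in> Sg" by (auto simp: Sg_def sa_semigroup_def)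
        from division[OF this P(1)]
        show "\<exists>W\<in>Sg \<union> {id_blinfun}. inv_into A (gelfand A) (char_fun \<Omega> S) = op_prod Ns o\<^sub>L W"
          unfolding inv by blast
      qed
      ultimately show ?thesis by (intro exI[of _ S]) (auto simp: S_def)
    qed
  next
    assume "\<exists>S\<subseteq>\<Omega>. ?supp S \<and> ?C0 S \<and> ?words S"
    then obtain S where S: "S \<subseteq> \<Omega>" and supp: "?supp S" and C0: "?C0 S" and words: "?words S"
      by blast
    define P where "P = inv_into A (gelfand A) (char_fun \<Omega> S)"
    show "simple_semigroup Sg"
      unfolding simple_semigroup_def
    proof (intro allI impI)
      fix J assume "semigroup_ideal Sg J"
      then have J: "J \<noteq> {}" "J \<subseteq> Sg" and ideal: "\<And>X Y. X \<in> J \<Longrightarrow> Y \<in> Sg \<Longrightarrow> X o\<^sub>L Y \<in> J"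
        by (auto simp: semigroup_ideal_def)
      then obtain X where X: "X \<in> J" by blast
      with J have "X \<in> Sg" by blast
      then obtain Ms where Ms: "X = op_prod Ms" "Ms \<noteq> []" "set Ms \<subseteq> F \<union> adj ` F"
        by (auto simp: Sg_def sa_semigroup_def)
      \<comment> \<open>The ideal is nonempty, so a generator exists; its support is
        \<open>S\<close>, which brings the indicator into the range of \<phi>.\<close>
      then obtain N where N: "N \<in> F" by (cases Ms) auto
      have "char_fun \<Omega> S \<in> gelfand A ` A"
        unfolding \<Omega>_def
      proof (rule char_fun_in_range_gelfand)
        show "char_fun (characters A) S \<in> C0 (char_space A)" using C0 by (simp add: \<Omega>_def)
        show "N \<in> A" using N FA by auto
        show "supp_on (characters A) (gelfand A N) = S"
          "supp_on (characters A) (gelfand A (adj N)) = S"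
          using supp N by (auto simp: \<Omega>_def)
      qed
      then have PA: "P \<in> A" and "gelfand A P = char_fun \<Omega> S"
        unfolding P_def by (auto intro: inv_into_into f_inv_into_f)
      then have \<omega>P: "\<omega> P = (if \<omega> \<in> S then 1 else 0)" if "\<omega> \<in> \<Omega>" for \<omega>
        using \<phi>[OF that, of P] that by (simp add: char_fun_def)
      have unit: "P o\<^sub>L T = T" if T: "T \<in> A" "\<And>\<omega>. \<omega> \<in> \<Omega> \<Longrightarrow> \<omega> \<notin> S \<Longrightarrow> \<omega> T = 0" for T
      proof (rule inj_onD[OF gelfand_inj])
        show "gelfand A (P o\<^sub>L T) = gelfand A T"
          unfolding gelfand_def \<Omega>_def[symmetric]
        proof (rule restrict_ext)
          fix \<omega> assume \<omega>: "\<omega> \<in> \<Omega>"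
          show "\<omega> (P o\<^sub>L T) = \<omega> T"
            using \<omega>_mult[OF \<omega> PA T(1)] T(2)[OF \<omega>] \<omega>P[OF \<omega>] by (cases "\<omega> \<in> S") auto
        qed
      qed (use A PA T in auto)
      have unit_gen: "P o\<^sub>L N = N" if "N \<in> F \<union> adj ` F" for N
      proof (rule unit)
        show "N \<in> A" using that FA by auto
        show "\<omega> N = 0" if "\<omega> \<in> \<Omega>" "\<omega> \<notin> S" for \<omega>
          using supp \<open>N \<in> F \<union> adj ` F\<close> that by (auto simp: supp_on_def \<phi>)
      qed
      have unit_Sg: "P o\<^sub>L T = T" if T: "T \<in> Sg" for T
      proof -
        obtain As where As: "T = op_prod As" "As \<noteq> []" "set As \<subseteq> F \<union> adj ` F"
          using T by (auto simp: Sg_def sa_semigroup_def)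
        then show ?thesis
          using unit_gen by (cases As) (auto simp flip: blinfun_compose_assoc)
      qed
      have PP: "P o\<^sub>L P = P" by (rule unit[OF PA]) (simp add: \<omega>P)
      \<comment> \<open>The word for \<open>X\<close> may repeat letters, while \<open>words\<close>
        concerns distinct lists. So it is applied to single letters only, and the equations are
        multiplied: with \<open>M\<close> the product of the remaining letters,
        \<open>P = P P = (N W1) (M W2) = (N M) (W1 W2)\<close>.\<close>
      have "\<exists>W\<in>Sg \<union> {id_blinfun}. P = op_prod Ms o\<^sub>L W"
        if "Ms \<noteq> []" "set Ms \<subseteq> F \<union> adj ` F" for Ms
        using that
      proof (induction Ms)
        case (Cons N Ms)
        have "\<exists>W\<in>Sg \<union> {id_blinfun}. P = op_prod [N] o\<^sub>L W"
          unfolding P_def by (rule words[rule_format]) (use Cons.prems in auto)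
        then obtain W1 where W1: "W1 \<in> Sg \<union> {id_blinfun}" "P = N o\<^sub>L W1"
          unfolding op_prod_Cons op_prod_Nil id_compose by blast
        show ?case
        proof (cases "Ms = []")
          case True
          then show ?thesis using W1 by auto
        next
          case False
          then obtain W2 where W2: "W2 \<in> Sg \<union> {id_blinfun}" "P = op_prod Ms o\<^sub>L W2"
            using Cons.IH Cons.prems unfolding set_simps insert_subset by blast
          have "op_prod Ms \<in> Sg" using Cons.prems False by (auto simp: Sg_def sa_semigroup_def)
          then have "W1 o\<^sub>L op_prod Ms = op_prod Ms o\<^sub>L W1" using W1 Sg_comm by auto
          then have "P = op_prod (N # Ms) o\<^sub>L (W1 o\<^sub>L W2)"
            using PP W1(2) W2(2) by (metis blinfun_compose_assoc op_prod_Cons)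
          moreover have "W1 o\<^sub>L W2 \<in> Sg \<union> {id_blinfun}" using W1 W2 Sg_mult by auto
          ultimately show ?thesis by blast
        qed
      qed simp
      then obtain W where W: "W \<in> Sg \<union> {id_blinfun}" "P = X o\<^sub>L W" using Ms by blast
      \<comment> \<open>If \<open>W\<close> is the identity, \<open>P = X\<close> lies in
        \<open>J\<close> already; otherwise the ideal property applies.\<close>
      then have PJ: "P \<in> J" using X ideal by auto
      have "T \<in> J" if "T \<in> Sg" for T
        using ideal[OF PJ that] unit_Sg[OF that] by simp
      then show "J = Sg" using J by blast
    qed
  qed
  then show ?thesis by (simp only: Let_def A_eq \<Omega>_def Sg_def)
qed

end
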